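(* Let $G_1$ and $G_2$ be finite simple connected graphs, let $Y$ be a nonempty graph which is a full subgraph of both $G_1$ and $G_2$, and let $G = G_1\cup_Y G_2$. Then $$\tau(G)=N(G_1,F,V(Y))\,N(G_2,F,V(Y))\,\tau\big(S(V(Y)),\boldsymbol{w}\big),$$ where $S(V(Y))$ is the Schur complement graph associated with $V(Y)$ in $G$ and $\boldsymbol{w}$ is the weight on it for which $\mathrm{DN}(G_1,Y,G_2)=\mathrm{DN}(G_1,Y)+\mathrm{DN}(G_2,Y)-L(Y)$ is the weighted Laplacian, i.e. $w_{vv'}=-\mathrm{DN}(G_1,Y,G_2)_{vv'}$ for $v\neq v'$ in $V(Y)$.
   Context: $\tau(H)$ denotes the number of spanning trees of $H$. For a weighted graph $(H,\boldsymbol{w})$, the spanning tree enumerator is $\tau(H,\boldsymbol{w})=\sum_{T}\prod_{\{u,v\}\in E(T)}w_{uv}$, the sum being over all spanning trees $T$ of $H$. With $k=|V(Y)|$, $N(G_i,F,V(Y))$ denotes the number of spanning forests of $G_i$ with exactly $k$ connected components that are rooted in $V(Y)$, i.e. each component contains exactly one vertex of $V(Y)$ (its root). A subgraph $Y$ of a graph $H$ is full if $u,v\in V(Y)$ and $\{u,v\}\in E(H)$ imply $\{u,v\}\in E(Y)$. If $Y$ is a full subgraph of $G_1$ and of $G_2$, then $G_1\cup_Y G_2$ is the graph obtained from the disjoint union of $G_1$ and $G_2$ by identifying the two copies of each vertex of $Y$ and the two copies of each edge of $Y$. $L(H)$ is the graph Laplacian: $L(H)(u,u)$ is the degree of $u$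 in $H$, $L(H)(u,v)=-1$ if $\{u,v\}\in E(H)$, and $0$ otherwise. Dirichlet-to-Neumann map: for a finite simple connected graph $H$ and a nonempty full subgraph $Y$ of $H$, write $L(H)=\begin{bmatrix} A & B\\ B^T & D\end{bmatrix}$ with $A$ indexed by $V(H)\setminus V(Y)$ and $D$ by $V(Y)$. Then $A$ is invertible and $\mathrm{DN}(H,Y)=D-B^TA^{-1}B$, a matrix indexed by $V(Y)$. The Schur complement graph $S(V(Y))$ of $V(Y)$ in $H$ has vertex set $V(Y)$, with distinct $v,v'$ adjacent iff $\mathrm{DN}(H,Y)_{vv'}\neq 0$. *)

theory Defs
  imports Complex_Main "Graph_Theory.Graph_Theory"
begin

text \<open>
  A finite simple graph is a \<open>pair_graph\<close>: a finite vertex set \<open>pverts H\<close> with an irreflexive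
  symmetric adjacency relation \<open>parcs H\<close>, so that each undirected edge is represented by two
  opposite arcs. Connectedness, full (induced) subgraphs, spanning subgraphs and connected
  components (\<open>sccs\<close>, which for symmetric digraphs are the connected components) are those of
  the library. Its \<open>forest\<close>, \<open>tree\<close> and \<open>spanning_tree\<close> only exclude directed cycles, and a
  single undirected edge is already a directed cycle of length two; hence the undirected notions
  below.
\<close>

definition edges :: "'v pair_pre_digraph \<Rightarrow> 'v set set" where
  "edges H = {{u, v} | u v. (u, v) \<in> parcs H}"

text \<open>In a simple graph the undirected cycles are the directed ones of length at least three.\<close>

definition acyclic_graph :: "'v pair_pre_digraph \<Rightarrow> bool" where
  "acyclic_graph H \<longleftrightarrow> \<not> (\<exists>p. pre_digraph.cycle (with_proj H) p \<and> 3 \<le> length p)"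

definition spanning_trees :: "'v pair_pre_digraph \<Rightarrow> 'v pair_pre_digraph set" where
  "spanning_trees H = {T. pair_graph T \<and> spanning (with_proj T) (with_proj H)
     \<and> Digraph_Component.connected (with_proj T) \<and> acyclic_graph T}"

definition num_spanning_trees :: "'v pair_pre_digraph \<Rightarrow> nat" where
  "num_spanning_trees H = card (spanning_trees H)"

definition rooted_spanning_forests :: "'v pair_pre_digraph \<Rightarrow> 'v set \<Rightarrow> 'v pair_pre_digraph set" where
  "rooted_spanning_forests H S = {F. pair_graph F \<and> spanning (with_proj F) (with_proj H)
     \<and> acyclic_graph F
     \<and> card (pre_digraph.sccs (with_proj F)) = card S
     \<and> (\<forall>C \<in> pre_digraph.sccs (with_proj F). \<exists>!v. v \<in> S \<and> v \<in> verts C)}"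

definition num_rooted_spanning_forests :: "'v pair_pre_digraph \<Rightarrow> 'v set \<Rightarrow> nat" where
  "num_rooted_spanning_forests H S = card (rooted_spanning_forests H S)"

text \<open>
  Edge weights are written \<open>w u v\<close>; as \<open>w\<close> is meant to be symmetric, the weight of an undirected
  edge \<open>{u, v}\<close> does not depend on the chosen order of its ends.
\<close>

definition edge_weight :: "('v \<Rightarrow> 'v \<Rightarrow> real) \<Rightarrow> 'v set \<Rightarrow> real" where
  "edge_weight w e = (THE r. \<exists>u v. e = {u, v} \<and> r = w u v)"

lemma edge_weight_eq:
  assumes "w u v = w v u"
  shows "edge_weight w {u, v} = w u v"
  unfolding edge_weight_def
  by (rule the_equality) (use assms in \<open>auto simp: doubleton_eq_iff\<close>)

definition spanning_tree_enumerator :: "'v pair_pre_digraph \<Rightarrow> ('v \<Rightarrow> 'v \<Rightarrow> real) \<Rightarrow> real" where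
  "spanning_tree_enumerator H w = (\<Sum>T \<in> spanning_trees H. \<Prod>e \<in> edges T. edge_weight w e)"

definition weighted_laplacian ::
    "'v pair_pre_digraph \<Rightarrow> ('v \<Rightarrow> 'v \<Rightarrow> real) \<Rightarrow> 'v \<Rightarrow> 'v \<Rightarrow> real" where
  "weighted_laplacian H w u v =
     (if u = v then \<Sum>x \<in> {x. (u, x) \<in> parcs H}. w u x
      else if (u, v) \<in> parcs H then - w u v else 0)"

definition laplacian :: "'v pair_pre_digraph \<Rightarrow> 'v \<Rightarrow> 'v \<Rightarrow> real" where
  "laplacian H u v =
     (if u = v then real (out_degree (with_proj H) u)
      else if (u, v) \<in> parcs H then - 1 else 0)"

text \<open>
  Matrices with rows and columns indexed by a finite set \<open>S\<close> are functions of two arguments, of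
  which only the values on \<open>S\<close> matter. For the inverse to be unique as a function, it is required
  to vanish outside \<open>S\<close>; if the matrix is not invertible, \<open>inverse_on\<close> is unspecified.
\<close>

definition is_inverse_on :: "'v set \<Rightarrow> ('v \<Rightarrow> 'v \<Rightarrow> real) \<Rightarrow> ('v \<Rightarrow> 'v \<Rightarrow> real) \<Rightarrow> bool" where
  "is_inverse_on S A B \<longleftrightarrow>
     (\<forall>x y. x \<notin> S \<or> y \<notin> S \<longrightarrow> B x y = 0) \<and>
     (\<forall>x \<in> S. \<forall>y \<in> S. (\<Sum>z\<in>S. A x z * B z y) = (if x = y then 1 else 0)) \<and>
     (\<forall>x \<in> S. \<forall>y \<in> S. (\<Sum>z\<in>S. B x z * A z y) = (if x = y then 1 else 0))"

definition inverse_on :: "'v set \<Rightarrow> ('v \<Rightarrow> 'v \<Rightarrow> real) \<Rightarrow> 'v \<Rightarrow> 'v \<Rightarrow> real" where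
  "inverse_on S A = (THE B. is_inverse_on S A B)"

lemma inverse_on_eq:
  assumes "finite S" and B: "is_inverse_on S A B"
  shows "inverse_on S A = B"
  unfolding inverse_on_def
proof (rule the_equality, rule B)
  fix C assume C: "is_inverse_on S A C"
  have "C x y = B x y" for x y
  proof (cases "x \<in> S \<and> y \<in> S")
    case True
    have "C x y = (\<Sum>z\<in>S. C x z * (if z = y then 1 else 0))"
      using True assms(1) by (simp add: if_distrib[of "\<lambda>c. _ * c"] cong: if_cong)
    also have "\<dots> = (\<Sum>z\<in>S. C x z * (\<Sum>t\<in>S. A z t * B t y))"
      using B True by (intro sum.cong) (auto simp: is_inverse_on_def)
    also have "\<dots> = (\<Sum>t\<in>S. (\<Sum>z\<in>S. C x z * A z t) * B t y)"
      unfolding sum_distrib_left sum_distrib_right mult.assoc by (rule sum.swap)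
    also have "\<dots> = (\<Sum>t\<in>S. (if x = t then 1 else 0) * B t y)"
      using C True by (intro sum.cong) (auto simp: is_inverse_on_def)
    also have "\<dots> = B x y"
      using True assms(1) by (simp add: if_distrib[of "\<lambda>c. c * _"] cong: if_cong)
    finally show ?thesis .
  next
    case False
    then show ?thesis using B C unfolding is_inverse_on_def by metis
  qed
  then show "C = B" by blast
qed

text \<open>
  The Dirichlet-to-Neumann map depends on the full subgraph only through its vertex set \<open>S\<close>. It is
  the Schur complement of the block of the Laplacian indexed by \<open>pverts H - S\<close>; only the entries
  indexed by \<open>S\<close> are meaningful.
\<close>

definition dirichlet_to_neumann :: "'v pair_pre_digraph \<Rightarrow> 'v set \<Rightarrow> 'v \<Rightarrow> 'v \<Rightarrow> real" where
  "dirichlet_to_neumann H S u v =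
     (let L = laplacian H; U = pverts H - S
      in L u v - (\<Sum>x\<in>U. \<Sum>y\<in>U. L u x * inverse_on U L x y * L y v))"

definition schur_complement_graph :: "'v pair_pre_digraph \<Rightarrow> 'v set \<Rightarrow> 'v pair_pre_digraph" where
  "schur_complement_graph H S =
     \<lparr>pverts = S,
      parcs = {(u, v). u \<in> S \<and> v \<in> S \<and> u \<noteq> v \<and> dirichlet_to_neumann H S u v \<noteq> 0}\<rparr>"

definition dirichlet_to_neumann_sum ::
    "'v pair_pre_digraph \<Rightarrow> 'v pair_pre_digraph \<Rightarrow> 'v pair_pre_digraph \<Rightarrow> 'v \<Rightarrow> 'v \<Rightarrow> real" where
  "dirichlet_to_neumann_sum G1 Y G2 u v =
     dirichlet_to_neumann G1 (pverts Y) u v + dirichlet_to_neumann G2 (pverts Y) u v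
       - laplacian Y u v"

text \<open>
  In the disjoint union, \<open>Inl\<close> and \<open>Inr\<close> tag the vertices of the first and the second graph.
  Identifying the two copies of \<open>Y\<close> amounts to tagging the vertices of \<open>Y\<close> in the second graph by
  \<open>Inl\<close> as well. Thus the two graphs may share vertices outside of \<open>Y\<close>, which are not identified,
  and the copy of \<open>Y\<close> in the glued graph has vertex set \<open>Inl ` pverts Y\<close>.
\<close>

definition glue_right :: "'a pair_pre_digraph \<Rightarrow> 'a \<Rightarrow> 'a + 'a" where
  "glue_right Y v = (if v \<in> pverts Y then Inl v else Inr v)"

definition glue ::
    "'a pair_pre_digraph \<Rightarrow> 'a pair_pre_digraph \<Rightarrow> 'a pair_pre_digraph \<Rightarrow> ('a + 'a) pair_pre_digraph"
  where
  "glue G1 Y G2 =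
     \<lparr>pverts = Inl ` pverts G1 \<union> glue_right Y ` pverts G2,
      parcs = map_prod Inl Inl ` parcs G1 \<union> map_prod (glue_right Y) (glue_right Y) ` parcs G2\<rparr>"

end

theory Submission
  imports Defs "Jordan_Normal_Form.Determinant"
begin

text \<open>
  Every count in the statement is a determinant, and the formula is the factorisation of one
  determinant by Schur complements.

  A forest rooted in a set \<open>S\<close> of vertices is the same as a map \<open>f\<close> that sends each vertex outside
  \<open>S\<close> to its parent, such that iterating \<open>f\<close> always leads into \<open>S\<close>. The total weight of these
  parent maps is the determinant of the block of the Laplacian indexed by the complement of \<open>S\<close>
  (\<open>det_lap_eq_sum_parent_maps\<close>): both sides are linear in each row of the weights, and if each row
  has a single nonzero weight then the weights describe one map \<open>f\<close> and the determinant only tests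
  whether \<open>f\<close> leads everywhere into \<open>S\<close>. The correspondence between forests and parent maps
  (\<open>sum_rooted_forests_eq_sum_parent_maps\<close>) turns this into formulas for the number of rooted
  forests, the number of spanning trees (one root) and the weighted spanning tree enumerator.

  Let \<open>G\<close> be the glued graph, \<open>r\<close> a vertex of \<open>Y\<close>, and let \<open>U1\<close>, \<open>U2\<close> be the vertices of the two
  graphs outside \<open>Y\<close>. Then \<open>\<tau>(G)\<close> is the determinant of the Laplacian of \<open>G\<close> without the row and
  column of \<open>r\<close>. Eliminating \<open>U1 \<union> U2\<close> (\<open>det_append_schur\<close>) factors it into the determinant of the
  block of \<open>U1 \<union> U2\<close> and the determinant of the Dirichlet-to-Neumann map of \<open>G\<close> without \<open>r\<close>. There
  is no edge between \<open>U1\<close> and \<open>U2\<close>, so the first factor is the product of the two forest counts.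
  For the same reason the corrections contributed by \<open>U1\<close> and \<open>U2\<close> to the Schur complement just
  add up, and the Dirichlet-to-Neumann map of \<open>G\<close> is \<open>DN(G1,Y) + DN(G2,Y) - L(Y)\<close>
  (\<open>dirichlet_to_neumann_glue\<close>). It is symmetric with vanishing row sums, hence the weighted
  Laplacian of the Schur complement graph, and so the second factor is the spanning tree
  enumerator of that graph.
\<close>

section \<open>A matrix tree theorem for parent maps\<close>

text \<open>
  The strictly decreasing rank \<open>d\<close> says that following parents cannot go on inside \<open>U\<close> forever;
  this form makes induction along parents immediate.
\<close>

definition parent_maps :: "'v set \<Rightarrow> 'v set \<Rightarrow> ('v \<Rightarrow> 'v) set" where
  "parent_maps U V = {f \<in> U \<rightarrow>\<^sub>E V. \<exists>d :: 'v \<Rightarrow> nat. \<forall>u\<in>U. d (f u) < d u}"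

definition mat_on :: "'v list \<Rightarrow> 'v list \<Rightarrow> ('v \<Rightarrow> 'v \<Rightarrow> real) \<Rightarrow> real mat" where
  "mat_on xs ys M = mat (length xs) (length ys) (\<lambda>(i, j). M (xs ! i) (ys ! j))"

text \<open>
  The Laplacian of the weights \<open>c\<close> on the vertex set \<open>V\<close>. A weight \<open>c u u\<close> cancels on the diagonal.
\<close>

definition lap :: "'v set \<Rightarrow> ('v \<Rightarrow> 'v \<Rightarrow> real) \<Rightarrow> 'v \<Rightarrow> 'v \<Rightarrow> real" where
  "lap V c u v = (if u = v then \<Sum>t\<in>V. c u t else 0) - c u v"

lemma mat_on_carrier [simp]: "mat_on xs ys M \<in> carrier_mat (length xs) (length ys)"
  by (simp add: mat_on_def)

lemma mat_on_cong:
  "(\<And>x y. x \<in> set xs \<Longrightarrow> y \<in> set ys \<Longrightarrow> M x y = N x y) \<Longrightarrow> mat_on xs ys M = mat_on xs ys N"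
  by (rule eq_matI) (auto simp: mat_on_def)

lemma sum_nth_distinct:
  assumes "distinct xs"
  shows "(\<Sum>i = 0..<length xs. g (xs ! i)) = (\<Sum>x\<in>set xs. g x)"
  using sum.reindex_bij_betw[OF bij_betw_nth[OF assms refl refl], of g] by (simp add: atLeast0LessThan)

lemma prod_nth_distinct:
  assumes "distinct xs"
  shows "(\<Prod>i = 0..<length xs. g (xs ! i)) = (\<Prod>x\<in>set xs. g x)"
  using prod.reindex_bij_betw[OF bij_betw_nth[OF assms refl refl], of g] by (simp add: atLeast0LessThan)

lemma ex_position_of:
  assumes "distinct xs"
  shows "\<exists>idx. \<forall>i<length xs. idx (xs ! i) = i"
  using the_inv_into_f_f[of "(!) xs" "{..<length xs}"] inj_on_nth[OF assms]
  by (intro exI[of _ "the_inv_into {..<length xs} ((!) xs)"]) auto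

lemma mat_on_mult:
  assumes "distinct ys"
  shows "mat_on xs ys M * mat_on ys zs N = mat_on xs zs (\<lambda>x z. \<Sum>y\<in>set ys. M x y * N y z)"
  by (rule eq_matI) (auto simp: mat_on_def scalar_prod_def sum_nth_distinct[OF assms, symmetric])

lemma mat_on_append:
  "mat_on (xs @ ys) (xs @ ys) M =
     four_block_mat (mat_on xs xs M) (mat_on xs ys M) (mat_on ys xs M) (mat_on ys ys M)"
  by (rule eq_matI) (auto simp: mat_on_def four_block_mat_def nth_append Let_def)

lemma det_mat_on:
  "det (mat_on xs xs M) =
     (\<Sum>p\<in>{p. p permutes {0..<length xs}}. signof p * (\<Prod>i = 0..<length xs. M (xs ! i) (xs ! p i)))"
  unfolding det_def'[OF mat_on_carrier]
proof (intro sum.cong refl arg_cong2[where f = "(*)"] prod.cong)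
  fix p i assume "p \<in> {p. p permutes {0..<length xs}}" "i \<in> {0..<length xs}"
  then have "p i < length xs" "i < length xs" using permutes_in_image[of p _ i] by auto
  then show "mat_on xs xs M $$ (i, p i) = M (xs ! i) (xs ! p i)" by (simp add: mat_on_def)
qed

text \<open>
  In the Leibniz formula a permutation \<open>p\<close> can only contribute if it maps each moved index to
  its parent. The parent is then moved again and has smaller rank, so no index can be moved at all and
  only the identity contributes.
\<close>

lemma det_parent_map:
  assumes xs: "distinct xs" and f: "f \<in> parent_maps (set xs) V"
  shows "det (mat_on xs xs (\<lambda>u v. of_bool (u = v) - of_bool (f u = v))) = 1"
proof -
  let ?n = "length xs"
  let ?M = "\<lambda>u v. of_bool (u = v) - of_bool (f u = v) :: real"
  obtain d :: "'a \<Rightarrow> nat" where d: "\<forall>u\<in>set xs. d (f u) < d u"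
    using f by (auto simp: parent_maps_def)
  have "(\<Prod>i = 0..<?n. ?M (xs ! i) (xs ! p i)) = 0" if p: "p permutes {0..<?n}" "p \<noteq> id" for p
  proof (rule ccontr)
    assume "\<not> ?thesis"
    then have nz: "?M (xs ! i) (xs ! p i) \<noteq> 0" if "i < ?n" for i
      using that by auto
    have moved: "\<exists>j. p j \<noteq> j \<and> d (xs ! j) < d (xs ! i)" if "p i \<noteq> i" for i
    proof -
      have i: "i < ?n" and pi: "p i < ?n"
        using that p(1) permutes_in_image[OF p(1), of i] by (auto simp: permutes_def)
      have "xs ! i \<noteq> xs ! p i"
        using xs i pi that by (simp add: nth_eq_iff_index_eq)
      with nz[OF i] have "f (xs ! i) = xs ! p i" by auto
      then have "d (xs ! p i) < d (xs ! i)" using d i by (metis nth_mem)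
      moreover have "p (p i) \<noteq> p i"
        using that permutes_inj[OF p(1)] by (auto dest: injD)
      ultimately show ?thesis by blast
    qed
    obtain i where "p i \<noteq> i" using p(2) by (auto simp: fun_eq_iff)
    then show False
    proof (induction "d (xs ! i)" arbitrary: i rule: less_induct)
      case less then show ?case using moved by blast
    qed
  qed
  then have "det (mat_on xs xs ?M) =
      (\<Sum>p\<in>{p. p permutes {0..<?n}}. if p = id then \<Prod>i = 0..<?n. ?M (xs ! i) (xs ! i) else 0)"
    unfolding det_mat_on by (intro sum.cong) auto
  also have "\<dots> = (\<Prod>i = 0..<?n. ?M (xs ! i) (xs ! i))"
    by (simp add: finite_permutations permutes_id sum.delta)
  also have "\<dots> = 1"
    using d by (intro prod.neutral) (auto, metis less_irrefl nth_mem)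
  finally show ?thesis .
qed

text \<open>
  The vertices whose iterated parents never leave \<open>set xs\<close> form a nonempty set \<open>C\<close> with
  \<open>f u \<in> C \<longleftrightarrow> u \<in> C\<close>. Hence the indicator vector of \<open>C\<close> lies in the kernel of the matrix.
\<close>

lemma det_not_parent_map:
  assumes xs: "distinct xs" and f: "f \<in> set xs \<rightarrow>\<^sub>E V" "f \<notin> parent_maps (set xs) V"
  shows "det (mat_on xs xs (\<lambda>u v. of_bool (u = v) - of_bool (f u = v))) = 0"
proof -
  let ?n = "length xs"
  let ?A = "mat_on xs xs (\<lambda>u v. of_bool (u = v) - of_bool (f u = v))"
  \<comment> \<open>Defined through iterates, \<open>C\<close> is closed under \<open>f\<close> and under preimages within \<open>set xs\<close>.\<close>
  define C where "C = {u \<in> set xs. \<forall>k. (f ^^ k) u \<in> set xs}"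
  have C_sub: "C \<subseteq> set xs" by (auto simp: C_def)
  have C_iff: "f u \<in> C \<longleftrightarrow> u \<in> C" if "u \<in> set xs" for u
  proof
    assume "f u \<in> C"
    then have "(f ^^ k) u \<in> set xs" for k
      using that by (cases k) (simp_all add: C_def funpow_Suc_right del: funpow.simps(2))
    with that show "u \<in> C" by (auto simp: C_def)
  next
    assume "u \<in> C"
    then have "(f ^^ Suc k) u \<in> set xs" for k unfolding C_def by blast
    then have "(f ^^ k) (f u) \<in> set xs" for k
      by (simp add: funpow_Suc_right del: funpow.simps(2))
    moreover from this[of 0] have "f u \<in> set xs" by simp
    ultimately show "f u \<in> C" by (simp add: C_def)
  qed
  have "C \<noteq> {}"
  proof
    assume "C = {}"
    \<comment> \<open>Otherwise the number of steps until \<open>set xs\<close> is left would be a decreasing rank.\<close>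
    define d where "d u = (LEAST k. (f ^^ k) u \<notin> set xs)" for u
    have "d (f u) < d u" if u: "u \<in> set xs" for u
    proof -
      have ex: "(f ^^ d u) u \<notin> set xs"
        using \<open>C = {}\<close> u LeastI_ex[of "\<lambda>k. (f ^^ k) u \<notin> set xs"] by (auto simp: C_def d_def)
      then obtain k where k: "d u = Suc k" using u by (cases "d u") auto
      with ex have "(f ^^ k) (f u) \<notin> set xs"
        by (simp add: funpow_Suc_right del: funpow.simps(2))
      then have "d (f u) \<le> k" unfolding d_def by (rule Least_le[of "\<lambda>k. (f ^^ k) (f u) \<notin> set xs"])
      with k show ?thesis by simp
    qed
    then have "\<exists>d :: 'a \<Rightarrow> nat. \<forall>u\<in>set xs. d (f u) < d u" by (intro exI[of _ d]) simp
    with f show False by (simp add: parent_maps_def)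
  qed
  then obtain u0 where "u0 \<in> C" by blast
  moreover from this have "u0 \<in> set xs" by (simp add: C_def)
  ultimately obtain i0 where i0: "i0 < ?n" "xs ! i0 \<in> C" by (metis in_set_conv_nth)
  define v where "v = vec ?n (\<lambda>i. of_bool (xs ! i \<in> C) :: real)"
  have "v \<noteq> 0\<^sub>v ?n" using i0 by (auto simp: v_def vec_eq_iff)
  moreover have "?A *\<^sub>v v = 0\<^sub>v ?n"
  proof (rule eq_vecI)
    fix i assume "i < dim_vec (0\<^sub>v ?n :: real vec)"
    then have i: "i < ?n" by simp
    let ?x = "xs ! i"
    have "(?A *\<^sub>v v) $ i =
        (\<Sum>j = 0..<?n. (of_bool (?x = xs ! j) - of_bool (f ?x = xs ! j)) * of_bool (xs ! j \<in> C))"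
      using i by (simp add: mat_on_def v_def scalar_prod_def)
    also have "\<dots> = (\<Sum>y\<in>set xs. (of_bool (?x = y) - of_bool (f ?x = y)) * of_bool (y \<in> C))"
      by (rule sum_nth_distinct[OF xs])
    also have "\<dots> = (\<Sum>y\<in>set xs. if ?x = y then of_bool (y \<in> C) else 0)
                  - (\<Sum>y\<in>set xs. if f ?x = y then of_bool (y \<in> C) else 0)"
      unfolding sum_subtractf[symmetric] by (rule sum.cong) auto
    also have "\<dots> = 0"
    proof -
      have "(\<Sum>y\<in>set xs. if z = y then of_bool (y \<in> C) else 0) = (of_bool (z \<in> C) :: real)" for z
        using C_sub by (subst sum.delta') auto
      then show ?thesis using i C_iff[of ?x] by simp
    qed
    finally show "(?A *\<^sub>v v) $ i = 0\<^sub>v ?n $ i" using i by simp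
  qed (simp add: mat_on_def)
  ultimately show ?thesis
    unfolding det_0_iff_vec_prod_zero[OF mat_on_carrier] by (intro exI[of _ v]) (simp add: v_def)
qed

text \<open>
  The row of \<open>u\<close> in the Laplacian is the sum over \<open>t\<close> of \<open>c u t\<close> times the row that belongs to the
  choice \<open>f u = t\<close>. Expanding the determinant by linearity in the rows gives a sum over all maps \<open>f\<close>
  of the weight of \<open>f\<close> times a determinant that is \<open>1\<close> for parent maps and \<open>0\<close> for all others.
\<close>

theorem det_lap_eq_sum_parent_maps:
  assumes xs: "distinct xs" and V: "finite V" "set xs \<subseteq> V"
  shows "det (mat_on xs xs (lap V c)) = (\<Sum>f\<in>parent_maps (set xs) V. \<Prod>u\<in>set xs. c u (f u))"
proof -
  let ?n = "length xs" and ?U = "set xs"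
  let ?P = "{p. p permutes {0..<?n}}"
  let ?D = "\<lambda>f u v. of_bool (u = v) - of_bool (f u = v) :: real"
  obtain idx where idx: "\<And>i. i < ?n \<Longrightarrow> idx (xs ! i) = i"
    using ex_position_of[OF xs] by blast
  have row: "lap V c u v = (\<Sum>t\<in>V. c u t * (of_bool (u = v) - of_bool (t = v)))"
    if "v \<in> V" for u v
  proof -
    have "(\<Sum>t\<in>V. c u t * of_bool (t = v)) = c u v"
      using V(1) that by (simp add: sum_mult_of_bool_eq Int_absorb1)
    then show ?thesis
      by (simp add: lap_def right_diff_distrib sum_subtractf sum_distrib_right[symmetric])
  qed
  have fin: "finite (?U \<rightarrow>\<^sub>E V)" using V by (intro finite_PiE) auto
  have summand: "(\<Prod>i = 0..<?n. lap V c (xs ! i) (xs ! p i)) =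
      (\<Sum>f\<in>?U \<rightarrow>\<^sub>E V. (\<Prod>u\<in>?U. c u (f u)) * (\<Prod>i = 0..<?n. ?D f (xs ! i) (xs ! p i)))"
    if p: "p permutes {0..<?n}" for p
  proof -
    have pin: "xs ! p i \<in> V" if "i < ?n" for i
      using subsetD[OF V(2) nth_mem] permutes_in_image[OF p, of i] that by simp
    have "(\<Prod>i = 0..<?n. lap V c (xs ! i) (xs ! p i)) =
        (\<Prod>i = 0..<?n. \<Sum>t\<in>V. c (xs ! i) t * (of_bool (xs ! i = xs ! p i) - of_bool (t = xs ! p i)))"
      using row pin by (intro prod.cong) auto
    also have "\<dots> = (\<Prod>i = 0..<?n. (\<lambda>u. \<Sum>t\<in>V.
        c u t * (of_bool (u = xs ! p (idx u)) - of_bool (t = xs ! p (idx u)))) (xs ! i))"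
      using idx by (intro prod.cong) auto
    also have "\<dots> = (\<Prod>u\<in>?U. \<Sum>t\<in>V. c u t * (of_bool (u = xs ! p (idx u)) - of_bool (t = xs ! p (idx u))))"
      by (rule prod_nth_distinct[OF xs])
    also have "\<dots> = (\<Sum>f\<in>?U \<rightarrow>\<^sub>E V. \<Prod>u\<in>?U. c u (f u) * ?D f u (xs ! p (idx u)))"
      using V by (subst prod_sum_PiE) auto
    also have "\<dots> = (\<Sum>f\<in>?U \<rightarrow>\<^sub>E V. (\<Prod>u\<in>?U. c u (f u)) * (\<Prod>u\<in>?U. ?D f u (xs ! p (idx u))))"
      by (simp add: prod.distrib)
    also have "\<dots> = (\<Sum>f\<in>?U \<rightarrow>\<^sub>E V. (\<Prod>u\<in>?U. c u (f u)) * (\<Prod>i = 0..<?n. ?D f (xs ! i) (xs ! p i)))"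
      unfolding prod_nth_distinct[OF xs, symmetric] using idx
      by (intro sum.cong refl arg_cong2[where f = "(*)"] prod.cong) auto
    finally show ?thesis .
  qed
  have "det (mat_on xs xs (lap V c)) =
      (\<Sum>p\<in>?P. \<Sum>f\<in>?U \<rightarrow>\<^sub>E V.
         (\<Prod>u\<in>?U. c u (f u)) * (signof p * (\<Prod>i = 0..<?n. ?D f (xs ! i) (xs ! p i))))"
    unfolding det_mat_on by (intro sum.cong refl) (simp add: summand sum_distrib_left mult.left_commute)
  also have "\<dots> = (\<Sum>f\<in>?U \<rightarrow>\<^sub>E V. (\<Prod>u\<in>?U. c u (f u)) * det (mat_on xs xs (?D f)))"
    unfolding det_mat_on sum_distrib_left by (rule sum.swap)
  also have "\<dots> = (\<Sum>f\<in>?U \<rightarrow>\<^sub>E V. if f \<in> parent_maps ?U V then \<Prod>u\<in>?U. c u (f u) else 0)"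
    using xs by (intro sum.cong) (auto simp: det_parent_map det_not_parent_map)
  also have "\<dots> = (\<Sum>f\<in>parent_maps ?U V. \<Prod>u\<in>?U. c u (f u))"
    using fin by (subst sum.inter_restrict[symmetric]) (auto simp: parent_maps_def intro!: sum.cong)
  finally show ?thesis .
qed

section \<open>Schur complements\<close>

text \<open>
  The result of eliminating the indices in \<open>U\<close>. Its entries are of interest for indices outside \<open>U\<close>.
\<close>

definition schur :: "'v set \<Rightarrow> ('v \<Rightarrow> 'v \<Rightarrow> real) \<Rightarrow> 'v \<Rightarrow> 'v \<Rightarrow> real" where
  "schur U M u v = M u v - (\<Sum>x\<in>U. \<Sum>y\<in>U. M u x * inverse_on U M x y * M y v)"

text \<open>
  Block elimination: with \<open>K = C A\<^sup>-\<^sup>1\<close> the matrix with blocks \<open>A, B, C, D\<close> is the product of the block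
  matrices \<open>1, 0, K, 1\<close> and \<open>A, B, 0, D - K B\<close>, both of which are block triangular.
\<close>

lemma det_append_schur:
  assumes xs: "distinct xs" and B: "is_inverse_on (set xs) M B"
  shows "det (mat_on (xs @ ys) (xs @ ys) M) =
    det (mat_on xs xs M) * det (mat_on ys ys (schur (set xs) M))"
proof -
  let ?n = "length xs" and ?m = "length ys" and ?U = "set xs"
  let ?K = "\<lambda>y x. \<Sum>z\<in>?U. M y z * B z x"
  have BM: "(\<Sum>x\<in>?U. B z x * M x v) = (if z = v then 1 else 0)" if "z \<in> ?U" "v \<in> ?U" for z v
    using B that unfolding is_inverse_on_def by blast
  have KM: "(\<Sum>x\<in>?U. ?K y x * M x v) = M y v" if "v \<in> ?U" for y v
  proof -
    have "(\<Sum>x\<in>?U. ?K y x * M x v) = (\<Sum>z\<in>?U. M y z * (\<Sum>x\<in>?U. B z x * M x v))"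
      unfolding sum_distrib_left sum_distrib_right mult.assoc by (rule sum.swap)
    also have "\<dots> = (\<Sum>z\<in>?U. M y z * (if z = v then 1 else 0))"
      using BM that by simp
    also have "\<dots> = M y v"
      using that by (simp add: if_distrib[of "\<lambda>c. _ * c"] cong: if_cong)
    finally show ?thesis .
  qed
  have S: "schur ?U M u v = M u v - (\<Sum>x\<in>?U. ?K u x * M x v)" for u v
    unfolding schur_def inverse_on_eq[OF finite_set B] sum_distrib_right by (subst sum.swap) simp
  let ?L = "four_block_mat (1\<^sub>m ?n) (0\<^sub>m ?n ?m) (mat_on ys xs ?K) (1\<^sub>m ?m)"
  let ?R = "four_block_mat (mat_on xs xs M) (mat_on xs ys M) (0\<^sub>m ?m ?n) (mat_on ys ys (schur ?U M))"
  have low: "mat_on ys xs ?K * mat_on xs xs M = mat_on ys xs M"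
    unfolding mat_on_mult[OF xs] using KM by (intro mat_on_cong)
  have corner: "mat_on ys xs ?K * mat_on xs ys M + mat_on ys ys (schur ?U M) = mat_on ys ys M"
    unfolding mat_on_mult[OF xs] by (rule eq_matI) (auto simp: mat_on_def S)
  have "?L * ?R = mat_on (xs @ ys) (xs @ ys) M"
    unfolding mat_on_append
    by (subst mult_four_block_mat[of _ ?n ?n _ ?m _ ?m _ _ ?n _ ?m])
      (simp_all add: low corner left_mult_one_mat[OF mat_on_carrier]
        left_mult_zero_mat[OF mat_on_carrier] right_mult_zero_mat[OF mat_on_carrier]
        right_add_zero_mat[OF mat_on_carrier])
  moreover have "det (?L * ?R) = det ?L * det ?R"
    by (rule det_mult[of _ "?n + ?m"]) (auto intro!: four_block_carrier_mat)
  ultimately have "det (mat_on (xs @ ys) (xs @ ys) M) = det ?L * det ?R" by simp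
  also have "det ?L = 1"
    by (subst det_four_block_mat_upper_right_zero[of _ ?n _ ?m]) auto
  also have "det ?R = det (mat_on xs xs M) * det (mat_on ys ys (schur ?U M))"
    by (rule det_four_block_mat_lower_left_zero[of _ ?n _ ?m]) auto
  finally show ?thesis by simp
qed

lemma ex_is_inverse_on:
  assumes xs: "distinct xs" and det: "det (mat_on xs xs M) \<noteq> 0"
  shows "\<exists>B. is_inverse_on (set xs) M B"
proof -
  let ?n = "length xs"
  obtain idx where idx: "\<And>i. i < ?n \<Longrightarrow> idx (xs ! i) = i"
    using ex_position_of[OF xs] by blast
  obtain N where N: "N \<in> carrier_mat ?n ?n" "mat_on xs xs M * N = 1\<^sub>m ?n" "N * mat_on xs xs M = 1\<^sub>m ?n"
    using det_non_zero_imp_unit[OF mat_on_carrier det, of "()"]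
    unfolding Units_def ring_mat_def by force
  define B where "B x y = (if x \<in> set xs \<and> y \<in> set xs then N $$ (idx x, idx y) else 0)" for x y
  have NB: "N = mat_on xs xs B"
    using N(1) by (intro eq_matI) (auto simp: mat_on_def B_def idx)
  have one: "(P :: real mat) = 1\<^sub>m ?n \<Longrightarrow> P = mat_on xs xs Q \<Longrightarrow> x \<in> set xs \<Longrightarrow> y \<in> set xs
      \<Longrightarrow> Q x y = (if x = y then 1 else 0)" for P Q x y
  proof -
    assume P: "P = 1\<^sub>m ?n" "P = mat_on xs xs Q" "x \<in> set xs" "y \<in> set xs"
    then obtain i j where ij: "i < ?n" "j < ?n" "x = xs ! i" "y = xs ! j" by (auto simp: in_set_conv_nth)
    from P have "mat_on xs xs Q $$ (i, j) = 1\<^sub>m ?n $$ (i, j)" by simp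
    with ij xs show ?thesis by (simp add: mat_on_def nth_eq_iff_index_eq)
  qed
  have "is_inverse_on (set xs) M B"
    unfolding is_inverse_on_def
  proof (intro conjI ballI allI impI)
    show "B x y = 0" if "x \<notin> set xs \<or> y \<notin> set xs" for x y
      using that by (auto simp: B_def)
  qed (rule one[OF N(2) mat_on_mult[OF xs, of xs M xs B, folded NB]], assumption+,
       rule one[OF N(3) mat_on_mult[OF xs, of xs B xs M, folded NB]], assumption+)
  then show ?thesis by blast
qed

lemma schur_sym:
  assumes U: "finite U" and B: "is_inverse_on U M B" and M: "\<And>x y. M x y = M y x"
  shows "schur U M u v = schur U M v u"
proof -
  have "is_inverse_on U M (\<lambda>x y. B y x)"
    using B M unfolding is_inverse_on_def
    by (auto simp: mult.commute)
  then have Bsym: "B y x = B x y" for x y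
    using inverse_on_eq[OF U B] inverse_on_eq[OF U, of M "\<lambda>x y. B y x"] by metis
  have "(\<Sum>x\<in>U. \<Sum>y\<in>U. M u x * B x y * M y v) = (\<Sum>x\<in>U. \<Sum>y\<in>U. M v x * B x y * M y u)"
    by (subst sum.swap) (simp add: M[of u] M[of _ v] Bsym mult.assoc mult.commute mult.left_commute)
  then show ?thesis unfolding schur_def inverse_on_eq[OF U B] by (simp add: M)
qed

text \<open>
  Vanishing row sums mean that \<open>M\<close> annihilates the constant vector. Eliminating the unknowns in \<open>U\<close>
  from this system of equations leaves the system of the Schur complement, for the constant vector
  on \<open>S\<close>.
\<close>

lemma schur_row_sum:
  assumes fin: "finite U" "finite S" "U \<inter> S = {}" and B: "is_inverse_on U M B"
    and M: "\<And>x. x \<in> U \<union> S \<Longrightarrow> (\<Sum>v\<in>U \<union> S. M x v) = 0" and u: "u \<in> S"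
  shows "(\<Sum>v\<in>S. schur U M u v) = 0"
proof -
  have split: "(\<Sum>v\<in>S. M x v) = - (\<Sum>z\<in>U. M x z)" if "x \<in> U \<union> S" for x
    using M[OF that] fin by (simp add: sum.union_disjoint)
  have BM: "(\<Sum>y\<in>U. B x y * M y z) = (if x = z then 1 else 0)" if "x \<in> U" "z \<in> U" for x z
    using B that unfolding is_inverse_on_def by blast
  have "(\<Sum>v\<in>S. \<Sum>x\<in>U. \<Sum>y\<in>U. M u x * B x y * M y v)
      = (\<Sum>x\<in>U. \<Sum>y\<in>U. M u x * B x y * (\<Sum>v\<in>S. M y v))"
    unfolding sum_distrib_left by (subst sum.swap, rule sum.cong[OF refl], rule sum.swap)
  also have "\<dots> = - (\<Sum>x\<in>U. \<Sum>y\<in>U. \<Sum>z\<in>U. M u x * (B x y * M y z))"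
    by (simp add: split sum_distrib_left sum_negf mult.assoc)
  also have "(\<Sum>x\<in>U. \<Sum>y\<in>U. \<Sum>z\<in>U. M u x * (B x y * M y z))
      = (\<Sum>x\<in>U. M u x * (\<Sum>z\<in>U. \<Sum>y\<in>U. B x y * M y z))"
    unfolding sum_distrib_left by (rule sum.cong[OF refl], rule sum.swap)
  also have "\<dots> = (\<Sum>x\<in>U. M u x)"
    using fin by (simp add: BM)
  finally show ?thesis
    using split[of u] u by (simp add: schur_def inverse_on_eq[OF fin(1) B] sum_subtractf)
qed

text \<open>
  An inverse on \<open>U1\<close> vanishes outside \<open>U1\<close>, so the inverse of a block diagonal matrix is simply the
  sum of the inverses of its blocks.
\<close>

lemma block_inverse:
  assumes fin: "finite U1" "finite U2" "U1 \<inter> U2 = {}"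
    and B1: "is_inverse_on U1 M B1" and B2: "is_inverse_on U2 M B2"
    and zero: "\<And>x y. x \<in> U1 \<Longrightarrow> y \<in> U2 \<Longrightarrow> M x y = 0 \<and> M y x = 0"
  shows "is_inverse_on (U1 \<union> U2) M (\<lambda>x y. B1 x y + B2 x y)"
proof -
  note 1 = B1[unfolded is_inverse_on_def] and 2 = B2[unfolded is_inverse_on_def]
  have out1: "B1 x y = 0" if "x \<notin> U1 \<or> y \<notin> U1" for x y using 1 that by blast
  have out2: "B2 x y = 0" if "x \<notin> U2 \<or> y \<notin> U2" for x y using 2 that by blast
  have MB1: "(\<Sum>z\<in>U1. M x z * B1 z y) = (if x = y then 1 else 0)"
    "(\<Sum>z\<in>U1. B1 x z * M z y) = (if x = y then 1 else 0)" if "x \<in> U1" "y \<in> U1" for x y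
    using 1 that by blast+
  have MB2: "(\<Sum>z\<in>U2. M x z * B2 z y) = (if x = y then 1 else 0)"
    "(\<Sum>z\<in>U2. B2 x z * M z y) = (if x = y then 1 else 0)" if "x \<in> U2" "y \<in> U2" for x y
    using 2 that by blast+
  have d: "x \<notin> U2" if "x \<in> U1" for x using that fin by blast
  have d': "x \<notin> U1" if "x \<in> U2" for x using that fin by blast
  show ?thesis
    unfolding is_inverse_on_def
  proof (intro conjI allI ballI impI)
    fix x y
    show "B1 x y + B2 x y = 0" if "x \<notin> U1 \<union> U2 \<or> y \<notin> U1 \<union> U2"
      using that out1 out2 by auto
    assume xy: "x \<in> U1 \<union> U2" "y \<in> U1 \<union> U2"
    show "(\<Sum>z\<in>U1 \<union> U2. M x z * (B1 z y + B2 z y)) = (if x = y then 1 else 0)"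
    proof (cases "x \<in> U1"; cases "y \<in> U1")
      assume "x \<in> U1" "y \<in> U1"
      then show ?thesis by (simp add: sum.union_disjoint[OF fin] MB1 out1 out2 d d')
    next
      assume a: "x \<in> U1" "y \<notin> U1"
      then have "x \<noteq> y" by blast
      with a show ?thesis by (simp add: sum.union_disjoint[OF fin] zero out1 out2 d d')
    next
      assume a: "x \<notin> U1" "y \<in> U1"
      then have "x \<noteq> y" "x \<in> U2" using xy by blast+
      with a show ?thesis by (simp add: sum.union_disjoint[OF fin] zero out1 out2 d d')
    next
      assume "x \<notin> U1" "y \<notin> U1"
      then have "x \<in> U2" "y \<in> U2" "x \<notin> U1" "y \<notin> U1" using xy by blast+
      then show ?thesis by (simp add: sum.union_disjoint[OF fin] MB2 out1 out2 d d')
    qed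
    show "(\<Sum>z\<in>U1 \<union> U2. (B1 x z + B2 x z) * M z y) = (if x = y then 1 else 0)"
    proof (cases "x \<in> U1"; cases "y \<in> U1")
      assume "x \<in> U1" "y \<in> U1"
      then show ?thesis by (simp add: sum.union_disjoint[OF fin] MB1 out1 out2 d d')
    next
      assume a: "x \<in> U1" "y \<notin> U1"
      then have "x \<noteq> y" "y \<in> U2" using xy by blast+
      with a show ?thesis by (simp add: sum.union_disjoint[OF fin] zero out1 out2 d d')
    next
      assume a: "x \<notin> U1" "y \<in> U1"
      then have "x \<noteq> y" by blast
      with a show ?thesis by (simp add: sum.union_disjoint[OF fin] zero out1 out2 d d')
    next
      assume "x \<notin> U1" "y \<notin> U1"
      then have "x \<in> U2" "y \<in> U2" "x \<notin> U1" "y \<notin> U1" using xy by blast+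
      then show ?thesis by (simp add: sum.union_disjoint[OF fin] MB2 out1 out2 d d')
    qed
  qed
qed

text \<open>
  Eliminating two uncoupled sets subtracts two independent corrections from \<open>M u v\<close>; adding the two
  separate Schur complements counts the entry \<open>M u v\<close> itself twice.
\<close>

lemma schur_union:
  assumes fin: "finite U1" "finite U2" "U1 \<inter> U2 = {}"
    and B1: "is_inverse_on U1 M B1" and B2: "is_inverse_on U2 M B2"
    and zero: "\<And>x y. x \<in> U1 \<Longrightarrow> y \<in> U2 \<Longrightarrow> M x y = 0 \<and> M y x = 0"
  shows "schur (U1 \<union> U2) M u v = schur U1 M u v + schur U2 M u v - M u v"
proof -
  have out1: "B1 x y = 0" if "x \<notin> U1 \<or> y \<notin> U1" for x y
    using B1 that unfolding is_inverse_on_def by blast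
  have out2: "B2 x y = 0" if "x \<notin> U2 \<or> y \<notin> U2" for x y
    using B2 that unfolding is_inverse_on_def by blast
  have d: "x \<notin> U2" if "x \<in> U1" for x using that fin by blast
  have d': "x \<notin> U1" if "x \<in> U2" for x using that fin by blast
  have "(\<Sum>x\<in>U1 \<union> U2. \<Sum>y\<in>U1 \<union> U2. M u x * (B1 x y + B2 x y) * M y v) =
      (\<Sum>x\<in>U1. \<Sum>y\<in>U1. M u x * B1 x y * M y v) + (\<Sum>x\<in>U2. \<Sum>y\<in>U2. M u x * B2 x y * M y v)"
    by (simp add: sum.union_disjoint[OF fin] out1 out2 d d')
  moreover have "inverse_on (U1 \<union> U2) M = (\<lambda>x y. B1 x y + B2 x y)"
    by (rule inverse_on_eq[OF finite_UnI[OF fin(1,2)] block_inverse[OF assms]])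
  ultimately show ?thesis
    by (simp add: schur_def inverse_on_eq[OF fin(1) B1] inverse_on_eq[OF fin(2) B2])
qed

lemma inverse_on_image:
  assumes g: "inj_on g U" and B: "is_inverse_on U M B"
    and M: "\<And>x y. x \<in> U \<Longrightarrow> y \<in> U \<Longrightarrow> N (g x) (g y) = M x y"
  shows "\<exists>C. is_inverse_on (g ` U) N C \<and> (\<forall>x\<in>U. \<forall>y\<in>U. C (g x) (g y) = B x y)"
proof -
  define C where "C a b = (if a \<in> g ` U \<and> b \<in> g ` U
    then B (inv_into U g a) (inv_into U g b) else 0)" for a b
  have C: "C (g x) (g y) = B x y" if "x \<in> U" "y \<in> U" for x y
    using that g by (simp add: C_def)
  have MB: "(\<Sum>z\<in>U. M x z * B z y) = (if x = y then 1 else 0)"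
    "(\<Sum>z\<in>U. B x z * M z y) = (if x = y then 1 else 0)" if "x \<in> U" "y \<in> U" for x y
    using B that unfolding is_inverse_on_def by blast+
  have "is_inverse_on (g ` U) N C"
    unfolding is_inverse_on_def
  proof (intro conjI allI ballI impI)
    show "C a b = 0" if "a \<notin> g ` U \<or> b \<notin> g ` U" for a b using that by (auto simp: C_def)
  next
    fix a b assume "a \<in> g ` U" "b \<in> g ` U"
    then obtain x y where xy: "x \<in> U" "y \<in> U" "a = g x" "b = g y" by blast
    then show "(\<Sum>z\<in>g ` U. N a z * C z b) = (if a = b then 1 else 0)"
      "(\<Sum>z\<in>g ` U. C a z * N z b) = (if a = b then 1 else 0)"
      using g by (simp_all add: sum.reindex M C MB inj_on_eq_iff)
  qed
  with C show ?thesis by blast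
qed

text \<open>
  The correction term of a Schur complement only involves entries with at least one index in the
  eliminated set. It is therefore unchanged when \<open>M\<close> is replaced by a matrix \<open>N\<close> that agrees with it
  there but differs at the entry \<open>(u, v)\<close>. This is the situation at the interface of a glued graph,
  where the degrees change.
\<close>

lemma schur_image:
  assumes U: "finite U" and g: "inj_on g U" and B: "is_inverse_on U M B"
    and M: "\<And>x y. x \<in> U \<Longrightarrow> y \<in> U \<Longrightarrow> N (g x) (g y) = M x y"
    and u: "\<And>x. x \<in> U \<Longrightarrow> N (g u) (g x) = M u x"
    and v: "\<And>x. x \<in> U \<Longrightarrow> N (g x) (g v) = M x v"
  shows "schur (g ` U) N (g u) (g v) = N (g u) (g v) - M u v + schur U M u v"
proof -
  obtain C where C: "is_inverse_on (g ` U) N C" "\<forall>x\<in>U. \<forall>y\<in>U. C (g x) (g y) = B x y"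
    using inverse_on_image[OF g B M] by blast
  show ?thesis
    using U C(2) unfolding schur_def inverse_on_eq[OF U B] inverse_on_eq[OF finite_imageI[OF U] C(1)]
    by (simp add: sum.reindex[OF g] u v)
qed

section \<open>Rooted forests as parent maps\<close>

definition graph_of_map :: "'v set \<Rightarrow> 'v set \<Rightarrow> ('v \<Rightarrow> 'v) \<Rightarrow> 'v pair_pre_digraph" where
  "graph_of_map U V f = \<lparr>pverts = V, parcs = (\<lambda>u. (u, f u)) ` U \<union> (\<lambda>u. (f u, u)) ` U\<rparr>"

lemma parcs_graph_of_map_iff:
  "(x, y) \<in> parcs (graph_of_map U V f) \<longleftrightarrow> x \<in> U \<and> y = f x \<or> y \<in> U \<and> x = f y"
  by (auto simp: graph_of_map_def)

text \<open>
  The rank is the distance to \<open>S\<close>, and a parent is the next vertex on a shortest path.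
\<close>

lemma ex_decreasing_parent_map:
  assumes "\<And>u. u \<in> U \<Longrightarrow> u \<notin> S \<and> (\<exists>s\<in>S. (u, s) \<in> E\<^sup>*)"
  shows "\<exists>f. \<exists>d :: 'v \<Rightarrow> nat. \<forall>u\<in>U. (u, f u) \<in> E \<and> d (f u) < d u"
proof -
  define d where "d u = (LEAST n. \<exists>s\<in>S. (u, s) \<in> E ^^ n)" for u
  have "\<exists>v. (u, v) \<in> E \<and> d v < d u" if u: "u \<in> U" for u
  proof -
    have "\<exists>n. \<exists>s\<in>S. (u, s) \<in> E ^^ n"
      using assms[OF u] rtrancl_power[of "(u, _)" E] by blast
    then obtain s where s: "s \<in> S" "(u, s) \<in> E ^^ d u"
      unfolding d_def by (rule LeastI_ex[THEN bexE])
    then obtain m where m: "d u = Suc m"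
      using assms[OF u] by (cases "d u") auto
    with s obtain v where v: "(u, v) \<in> E" "(v, s) \<in> E ^^ m"
      by (metis relpow_Suc_D2)
    have "d v \<le> m"
      unfolding d_def by (rule Least_le) (use s v in blast)
    with v m show ?thesis by auto
  qed
  then show ?thesis by metis
qed

lemma pair_graph_graph_of_map:
  assumes "finite V" "U \<subseteq> V" "f \<in> parent_maps U V"
  shows "pair_graph (graph_of_map U V f)"
proof -
  have fU: "finite U" using assms finite_subset by blast
  have fV: "\<forall>u\<in>U. f u \<in> V \<and> f u \<noteq> u" using assms(3) by (fastforce simp: parent_maps_def)
  show ?thesis
  proof unfold_locales
    show "symmetric (with_proj (graph_of_map U V f))"
      by (auto simp: symmetric_def graph_of_map_def intro!: symI)
  qed (use assms fU fV in \<open>auto simp: graph_of_map_def\<close>)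
qed

lemma pawalk_verts_pcas: "pcas u p v \<Longrightarrow> pawalk_verts u p = u # map snd p"
  by (induction p arbitrary: u) auto

lemma pcas_nth_Suc: "pcas u p v \<Longrightarrow> Suc i < length p \<Longrightarrow> fst (p ! Suc i) = snd (p ! i)"
proof (induction p arbitrary: u i)
  case (Cons e p)
  then show ?case by (cases i; cases p) auto
qed simp

lemma pcas_ends: "pcas u p v \<Longrightarrow> p \<noteq> [] \<Longrightarrow> fst (p ! 0) = u \<and> snd (p ! (length p - 1)) = v"
proof (induction p arbitrary: u)
  case (Cons e p)
  then show ?case by (cases p) auto
qed simp

lemma cycle_with_proj_iff:
  "pre_digraph.cycle (with_proj G) p \<longleftrightarrow>
    p \<noteq> [] \<and> set p \<subseteq> parcs G \<and>
    (\<exists>u\<in>pverts G. pcas u p u \<and> distinct (tl (pawalk_verts u p)))"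
  unfolding pre_digraph.cycle_def pre_digraph.awalk_def
  by (auto simp: cas_with_proj_eq awalk_verts_with_proj_eq)

text \<open>
  On a cycle of length at least three, a vertex of maximal rank has two distinct neighbours. A
  neighbour of no larger rank can only be the parent, and there is only one parent.
\<close>

lemma acyclic_graph_of_map:
  assumes f: "f \<in> parent_maps U V"
  shows "acyclic_graph (graph_of_map U V f)"
  unfolding acyclic_graph_def
proof
  let ?T = "graph_of_map U V f"
  assume "\<exists>p. pre_digraph.cycle (with_proj ?T) p \<and> 3 \<le> length p"
  then obtain p u where p: "set p \<subseteq> parcs ?T" "pcas u p u" "distinct (tl (pawalk_verts u p))" "3 \<le> length p"
    unfolding cycle_with_proj_iff by blast
  obtain d :: "'a \<Rightarrow> nat" where d: "\<And>u. u \<in> U \<Longrightarrow> d (f u) < d u"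
    using f by (auto simp: parent_maps_def)
  let ?n = "length p"
  have dist: "distinct (map snd p)" using p pawalk_verts_pcas by fastforce
  have "(\<lambda>e. d (snd e)) ` set p \<noteq> {}" using p(4) by auto
  then have "Max ((\<lambda>e. d (snd e)) ` set p) \<in> (\<lambda>e. d (snd e)) ` set p"
    by (intro Max_in) auto
  then obtain e where e: "e \<in> set p" "d (snd e) = Max ((\<lambda>e. d (snd e)) ` set p)"
    by auto
  obtain i where i: "i < ?n" "e = p ! i" using e(1) by (auto simp: in_set_conv_nth)
  \<comment> \<open>The arc at position \<open>i\<close> enters the vertex of maximal rank. The arcs at \<open>j\<close> and \<open>k\<close> enter
    its successor and its predecessor; \<open>j \<noteq> k\<close> as the length is at least three.\<close>
  define j where "j = (if Suc i = ?n then 0 else Suc i)"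
  define k where "k = (if i = 0 then ?n - 1 else i - 1)"
  have jk: "j < ?n" "k < ?n" "j \<noteq> k" using i p(4) by (auto simp: j_def k_def)
  have ends: "fst (p ! 0) = u" "snd (p ! (?n - 1)) = u" using pcas_ends[OF p(2)] p(4) by force+
  have "fst (p ! j) = snd (p ! i)"
  proof (cases "Suc i = ?n")
    case True
    then have "i = ?n - 1" by simp
    with True ends show ?thesis by (simp add: j_def)
  qed (use i pcas_nth_Suc[OF p(2), of i] in \<open>simp add: j_def\<close>)
  moreover have "fst (p ! i) = snd (p ! k)"
    using pcas_nth_Suc[OF p(2), of "i - 1"] ends i by (cases i) (auto simp: k_def)
  ultimately have arcs: "(snd e, snd (p ! j)) \<in> parcs ?T" "(snd (p ! k), snd e) \<in> parcs ?T"
    using p(1) i jk by (metis nth_mem prod.collapse subsetD)+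
  have "d (snd (p ! j)) \<le> d (snd e)" "d (snd (p ! k)) \<le> d (snd e)"
    unfolding e(2) using jk by (auto intro!: Max_ge)
  with arcs d have "snd (p ! j) = f (snd e)" "snd (p ! k) = f (snd e)"
    unfolding parcs_graph_of_map_iff by (metis leD)+
  with jk show False using nth_eq_iff_index_eq[OF dist, of j k] by simp
qed

lemma graph_of_map_ex_root:
  assumes f: "f \<in> parent_maps U V" and v: "v \<in> V"
  shows "\<exists>s\<in>V - U. (v, s) \<in> (parcs (graph_of_map U V f))\<^sup>*"
proof -
  obtain d :: "'a \<Rightarrow> nat" where d: "\<And>u. u \<in> U \<Longrightarrow> d (f u) < d u" and fV: "\<And>u. u \<in> U \<Longrightarrow> f u \<in> V"
    using f by (auto simp: parent_maps_def)
  show ?thesis using v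
  proof (induction "d v" arbitrary: v rule: less_induct)
    case less
    show ?case
    proof (cases "v \<in> U")
      case True
      then obtain s where "s \<in> V - U" "(f v, s) \<in> (parcs (graph_of_map U V f))\<^sup>*"
        using less.hyps[OF d fV] by blast
      moreover have "(v, f v) \<in> parcs (graph_of_map U V f)" using True by (simp add: parcs_graph_of_map_iff)
      ultimately show ?thesis by (meson converse_rtrancl_into_rtrancl)
    qed (use less in blast)
  qed
qed

text \<open>
  Going along an edge in either direction does not change which root is found by following
  parents. So a walk to a root \<open>s'\<close> can be replaced by a chain of parents, and the chain that
  starts at a root is trivial.
\<close>

lemma graph_of_map_root_unique:
  assumes s: "s \<notin> U" "s' \<notin> U" and walk: "(s, s') \<in> (parcs (graph_of_map U V f))\<^sup>*"
  shows "s = s'"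
proof -
  let ?R = "(\<lambda>u. (u, f u)) ` U"
  have "(s, s') \<in> ?R\<^sup>*"
    using walk
  proof (induction rule: converse_rtrancl_induct)
    case (step x y)
    then consider "x \<in> U" "y = f x" | "y \<in> U" "x = f y"
      unfolding parcs_graph_of_map_iff by blast
    then show ?case
    proof cases
      case 1
      then have "(x, y) \<in> ?R" by blast
      with step.IH show ?thesis by (rule converse_rtrancl_into_rtrancl[rotated])
    next
      case 2
      with step.IH s(2) show ?thesis by (auto elim: converse_rtranclE)
    qed
  qed simp
  with s(1) show ?thesis by (auto elim: converse_rtranclE)
qed

lemma sym_rtrancl_iff: "sym E \<Longrightarrow> (x, y) \<in> E\<^sup>* \<longleftrightarrow> (y, x) \<in> E\<^sup>*"
  by (meson sym_rtrancl symD)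

lemma (in pair_wf_digraph) reachable_iff_rtrancl:
  "u \<in> pverts G \<Longrightarrow> u \<rightarrow>\<^sup>*\<^bsub>with_proj G\<^esub> v \<longleftrightarrow> (u, v) \<in> (parcs G)\<^sup>*"
proof
  assume u: "u \<in> pverts G" and walk: "(u, v) \<in> (parcs G)\<^sup>*"
  from walk u have "v \<in> pverts G" by (induction rule: rtrancl_induct) (auto dest: in_arcsD2)
  with u walk show "u \<rightarrow>\<^sup>*\<^bsub>with_proj G\<^esub> v"
    unfolding reachable_def
    by (auto intro!: rtrancl_consistent_rtrancl_on dest: in_arcsD2)
qed (auto simp: reachable_def dest: rtrancl_on_rtranclI)

lemma (in pair_graph) sym_parcs: "sym (parcs G)"
  using pair_sym_arcs by (simp add: symmetric_def)

lemma (in pair_graph) arc_verts: "(u, v) \<in> parcs G \<Longrightarrow> u \<noteq> v \<and> u \<in> pverts G \<and> v \<in> pverts G"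
  using in_arcsD1 in_arcsD2 no_loops' by blast

lemma (in pair_graph) ex_path:
  assumes "u \<in> pverts G" "(u, v) \<in> (parcs G)\<^sup>*"
  shows "\<exists>p. set p \<subseteq> parcs G \<and> pcas u p v \<and> distinct (pawalk_verts u p)"
proof -
  have "u \<rightarrow>\<^sup>*\<^bsub>with_proj G\<^esub> v" using assms reachable_iff_rtrancl by blast
  then obtain p where "apath u p v" using reachable_apath by blast
  then show ?thesis by (auto simp: apath_def awalk_def)
qed

lemma (in pair_graph) scc_of_eq_reachable:
  "v \<in> pverts G \<Longrightarrow> scc_of v = {x. (v, x) \<in> (parcs G)\<^sup>*}"
  unfolding scc_of_def
  using symmetric_reachable[OF sym_arcs] reachable_iff_rtrancl by blast

lemma (in pair_graph) connected_iff_reach: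
  assumes r: "r \<in> pverts G"
  shows "Digraph_Component.connected (with_proj G) \<longleftrightarrow> (\<forall>v\<in>pverts G. (v, r) \<in> (parcs G)\<^sup>*)"
proof
  assume "Digraph_Component.connected (with_proj G)"
  then have "strongly_connected (with_proj G)"
    using symmetric_connected_imp_strongly_connected[OF sym_arcs] by blast
  then show "\<forall>v\<in>pverts G. (v, r) \<in> (parcs G)\<^sup>*"
    using r reachable_iff_rtrancl by (auto simp: strongly_connected_def)
next
  assume *: "\<forall>v\<in>pverts G. (v, r) \<in> (parcs G)\<^sup>*"
  have "u \<rightarrow>\<^sup>*\<^bsub>with_proj G\<^esub> v" if "u \<in> pverts G" "v \<in> pverts G" for u v
    using * that sym_rtrancl_iff[OF sym_parcs, of v r] reachable_iff_rtrancl[of u v]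
    by (meson rtrancl_trans)
  then show "Digraph_Component.connected (with_proj G)"
    using r by (intro connectedI reachable_mk_symmetricI) auto
qed

text \<open>
  In a symmetric digraph the component of \<open>v\<close> consists of the vertices reachable from \<open>v\<close>. If every
  component contains exactly one vertex of \<open>S\<close>, then mapping a vertex of \<open>S\<close> to its component is a
  bijection, which determines the number of components.
\<close>

lemma (in pair_graph) sccs_rooted_iff:
  assumes S: "S \<subseteq> pverts G"
  shows "card sccs = card S \<and> (\<forall>C\<in>sccs. \<exists>!v. v \<in> S \<and> v \<in> verts C) \<longleftrightarrow>
    (\<forall>v\<in>pverts G. \<exists>!s. s \<in> S \<and> (v, s) \<in> (parcs G)\<^sup>*)" (is "?card \<and> ?L \<longleftrightarrow> ?R")
proof -
  have "?L \<longleftrightarrow> (\<forall>C\<in>sccs_verts. \<exists>!v. v \<in> S \<and> v \<in> C)"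
    unfolding sccs_verts_conv by blast
  also have "\<dots> \<longleftrightarrow> ?R"
    unfolding sccs_verts_conv_scc_of using scc_of_eq_reachable by auto
  finally have LR: "?L \<longleftrightarrow> ?R" .
  have card: ?card if R: ?R
  proof -
    have "inj_on scc_of S"
    proof (rule inj_onI)
      fix s t assume st: "s \<in> S" "t \<in> S" "scc_of s = scc_of t"
      then have "(s, t) \<in> (parcs G)\<^sup>*" using scc_of_eq_reachable[of s] scc_of_eq_reachable[of t] S by blast
      with R st S show "s = t" by blast
    qed
    moreover have "scc_of ` S = scc_of ` pverts G"
    proof
      show "scc_of ` pverts G \<subseteq> scc_of ` S"
      proof
        fix C assume "C \<in> scc_of ` pverts G"
        then obtain v where v: "v \<in> pverts G" "C = scc_of v" by blast
        with R obtain s where s: "s \<in> S" "(v, s) \<in> (parcs G)\<^sup>*" by blast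
        then have "s \<in> scc_of v" using v scc_of_eq_reachable by blast
        then show "C \<in> scc_of ` S" using v s scc_of_eq by blast
      qed
    qed (use S in blast)
    ultimately have "card S = card sccs_verts"
      unfolding sccs_verts_conv_scc_of by (metis card_image)
    then show ?thesis by (simp add: card_sccs_verts)
  qed
  have "a \<and> l \<longleftrightarrow> b" if "l \<longleftrightarrow> b" "b \<Longrightarrow> a" for a l b using that by blast
  from this[OF LR card] show ?thesis .
qed

lemma rooted_spanning_forests_iff:
  assumes S: "S \<subseteq> pverts H"
  shows "F \<in> rooted_spanning_forests H S \<longleftrightarrow>
    pair_graph F \<and> spanning (with_proj F) (with_proj H) \<and> acyclic_graph F
    \<and> (\<forall>v\<in>pverts F. \<exists>!s. s \<in> S \<and> (v, s) \<in> (parcs F)\<^sup>*)"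
proof (cases "pair_graph F \<and> pverts F = pverts H")
  case True
  then show ?thesis
    using pair_graph.sccs_rooted_iff[of F S] S unfolding rooted_spanning_forests_def by simp
qed (auto simp: rooted_spanning_forests_def spanning_def)

lemma spanning_trees_eq_rooted_forests:
  assumes r: "r \<in> pverts H"
  shows "spanning_trees H = rooted_spanning_forests H {r}"
proof (rule Set.set_eqI)
  fix T :: "'a pair_pre_digraph"
  have one: "(\<exists>!s. s \<in> {r} \<and> (v, s) \<in> (parcs T)\<^sup>*) \<longleftrightarrow> (v, r) \<in> (parcs T)\<^sup>*" for v
    by auto
  have S: "{r} \<subseteq> pverts H" using r by simp
  show "T \<in> spanning_trees H \<longleftrightarrow> T \<in> rooted_spanning_forests H {r}"
  proof (cases "pair_graph T \<and> pverts T = pverts H")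
    case True
    then show ?thesis
      using r pair_graph.connected_iff_reach[of T r]
      unfolding rooted_spanning_forests_iff[OF S] one spanning_trees_def by auto
  next
    case False
    then show ?thesis
      unfolding rooted_spanning_forests_iff[OF S] spanning_trees_def spanning_def by auto
  qed
qed

text \<open>
  If \<open>g u\<close> is not the parent of \<open>u\<close> under \<open>f\<close>, then the common edge \<open>{u, g u}\<close> must come from
  \<open>f (g u) = u\<close>. By induction on the rank, \<open>f\<close> and \<open>g\<close> agree at \<open>g u\<close>, which makes \<open>u\<close> and \<open>g u\<close> parents of each other.
\<close>

lemma inj_on_graph_of_map: "inj_on (graph_of_map U V) (parent_maps U V)"
proof (rule inj_onI)
  fix f g assume f: "f \<in> parent_maps U V" and g: "g \<in> parent_maps U V"
    and eq: "graph_of_map U V f = graph_of_map U V g"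
  obtain d :: "'a \<Rightarrow> nat" where d: "\<And>u. u \<in> U \<Longrightarrow> d (g u) < d u"
    using g by (auto simp: parent_maps_def)
  have "f u = g u" if "u \<in> U" for u
    using that
  proof (induction "d u" arbitrary: u rule: less_induct)
    case less
    have "(u, g u) \<in> parcs (graph_of_map U V f)"
      using less.prems unfolding eq by (simp add: parcs_graph_of_map_iff)
    then consider "g u = f u" | "g u \<in> U" "u = f (g u)"
      unfolding parcs_graph_of_map_iff by blast
    then show ?case
    proof cases
      case 2
      then have "u = g (g u)" using less.hyps[OF d[OF less.prems]] by simp
      with d[OF less.prems] d[OF 2(1)] show ?thesis by simp
    qed simp
  qed
  then show "f = g"
    using f g by (intro extensionalityI[of f U g]) (auto simp: parent_maps_def PiE_def)
qed

lemma edges_graph_of_map: "edges (graph_of_map U V f) = (\<lambda>u. {u, f u}) ` U"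
  by (auto simp: edges_def parcs_graph_of_map_iff insert_commute)

lemma prod_edges_graph_of_map:
  assumes f: "f \<in> parent_maps U V" and w: "\<And>u. u \<in> U \<Longrightarrow> w u (f u) = w (f u) u"
  shows "(\<Prod>e\<in>edges (graph_of_map U V f). edge_weight w e) = (\<Prod>u\<in>U. w u (f u))"
proof -
  obtain d :: "'a \<Rightarrow> nat" where d: "\<And>u. u \<in> U \<Longrightarrow> d (f u) < d u"
    using f by (auto simp: parent_maps_def)
  have "inj_on (\<lambda>u. {u, f u}) U"
  proof (rule inj_onI)
    fix u v assume uv: "u \<in> U" "v \<in> U" "{u, f u} = {v, f v}"
    then show "u = v" using d[of u] d[of v] by (auto simp: doubleton_eq_iff)
  qed
  then show ?thesis
    unfolding edges_graph_of_map using w by (simp add: prod.reindex edge_weight_eq)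
qed

lemma graph_of_map_rooted_forest:
  assumes H: "pair_wf_digraph H" "finite (pverts H)" "sym (parcs H)" and S: "S \<subseteq> pverts H"
    and f: "f \<in> parent_maps (pverts H - S) (pverts H)"
    and arcs: "\<And>u. u \<in> pverts H - S \<Longrightarrow> (u, f u) \<in> parcs H"
  shows "graph_of_map (pverts H - S) (pverts H) f \<in> rooted_spanning_forests H S"
proof -
  let ?V = "pverts H" let ?U = "?V - S" let ?T = "graph_of_map ?U ?V f"
  have pg: "pair_graph ?T" using H(2) f by (intro pair_graph_graph_of_map) auto
  then have wf: "pair_wf_digraph ?T"
    by (simp add: pair_graph_def pair_digraph_def pair_fin_digraph_def)
  \<comment> \<open>Both directions of a tree edge are arcs since \<open>H\<close> is symmetric.\<close>
  have sub: "parcs ?T \<subseteq> parcs H"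
    using arcs symD[OF H(3)] by (auto simp: graph_of_map_def)
  have "\<exists>!s. s \<in> S \<and> (v, s) \<in> (parcs ?T)\<^sup>*" if v: "v \<in> ?V" for v
  proof -
    obtain s where s: "s \<in> S" "(v, s) \<in> (parcs ?T)\<^sup>*"
      using graph_of_map_ex_root[OF f v] by blast
    have "t = s" if "t \<in> S" "(v, t) \<in> (parcs ?T)\<^sup>*" for t
    proof -
      have "(t, v) \<in> (parcs ?T)\<^sup>*"
        using that sym_rtrancl_iff[OF pair_graph.sym_parcs[OF pg]] by blast
      with s have "(t, s) \<in> (parcs ?T)\<^sup>*" by (meson rtrancl_trans)
      then show ?thesis using that s by (intro graph_of_map_root_unique) auto
    qed
    with s show ?thesis by blast
  qed
  moreover have "pverts ?T = ?V" by (simp add: graph_of_map_def)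
  ultimately show ?thesis
    using pg wf H(1) sub acyclic_graph_of_map[OF f]
    unfolding rooted_spanning_forests_iff[OF S]
    by (auto simp: spanning_def subgraph_def compatible_def wf_digraph_wp_iff)
qed

text \<open>
  Parents towards the nearest root give a parent map with graph \<open>T\<close> inside \<open>F\<close>. If \<open>F\<close> had another
  edge \<open>{a, b}\<close>, then \<open>a\<close> and \<open>b\<close> would have the same root, and a path between them in \<open>T\<close> would close up
  with \<open>{a, b}\<close> to a cycle of length at least three in \<open>F\<close>.
\<close>

lemma rooted_forest_is_graph_of_map:
  assumes H: "finite (pverts H)" and S: "S \<subseteq> pverts H"
    and F: "F \<in> rooted_spanning_forests H S"
  shows "\<exists>f \<in> parent_maps (pverts H - S) (pverts H).
    (\<forall>u\<in>pverts H - S. (u, f u) \<in> parcs H) \<and> F = graph_of_map (pverts H - S) (pverts H) f"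
proof -
  let ?V = "pverts H" let ?U = "?V - S"
  have F_pg: "pair_graph F" and sub: "parcs F \<subseteq> parcs H" and V: "pverts F = ?V"
    and acyc: "acyclic_graph F" and root: "\<And>v. v \<in> ?V \<Longrightarrow> \<exists>!s. s \<in> S \<and> (v, s) \<in> (parcs F)\<^sup>*"
    using F unfolding rooted_spanning_forests_iff[OF S] by (auto simp: spanning_def subgraph_def)
  note F_arc = pair_graph.arc_verts[OF F_pg] and F_sym = symD[OF pair_graph.sym_parcs[OF F_pg]]
  have "\<exists>f. \<exists>d :: 'a \<Rightarrow> nat. \<forall>u\<in>?U. (u, f u) \<in> parcs F \<and> d (f u) < d u"
    using root by (intro ex_decreasing_parent_map[of _ S]) blast
  then obtain g and d :: "'a \<Rightarrow> nat"
    where g: "\<forall>u\<in>?U. (u, g u) \<in> parcs F \<and> d (g u) < d u" by blast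
  define f where "f = restrict g ?U"
  have f_arc: "(u, f u) \<in> parcs F" and fd: "d (f u) < d u" if "u \<in> ?U" for u
    using g that by (auto simp: f_def)
  have fpm: "f \<in> parent_maps ?U ?V"
    unfolding parent_maps_def using f_arc fd F_arc V by (auto simp: f_def)
  let ?T = "graph_of_map ?U ?V f"
  have T_pg: "pair_graph ?T" using H fpm by (intro pair_graph_graph_of_map) auto
  note T_sym = pair_graph.sym_parcs[OF T_pg]
  have VT: "pverts ?T = ?V" by (simp add: graph_of_map_def)
  have TF: "parcs ?T \<subseteq> parcs F"
    using f_arc F_sym by (auto simp: graph_of_map_def)
  have "parcs F \<subseteq> parcs ?T"
  proof (rule ccontr)
    assume "\<not> ?thesis"
    then obtain a b where ab: "(a, b) \<in> parcs F" "(a, b) \<notin> parcs ?T" by auto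
    then have abV: "a \<in> ?V" "b \<in> ?V" using F_arc V by auto
    obtain s where s: "s \<in> S" "(a, s) \<in> (parcs ?T)\<^sup>*"
      using graph_of_map_ex_root[OF fpm abV(1)] by blast
    obtain t where t: "t \<in> S" "(b, t) \<in> (parcs ?T)\<^sup>*"
      using graph_of_map_ex_root[OF fpm abV(2)] by blast
    have "(a, s) \<in> (parcs F)\<^sup>*" "(a, t) \<in> (parcs F)\<^sup>*"
      using s t ab(1) rtrancl_mono[OF TF] by (auto intro: converse_rtrancl_into_rtrancl)
    with root[OF abV(1)] s t have "s = t" by blast
    then have "(b, a) \<in> (parcs ?T)\<^sup>*"
      using s(2) t(2) sym_rtrancl_iff[OF T_sym, of a s] by (meson rtrancl_trans)
    then obtain p where p: "set p \<subseteq> parcs ?T" "pcas b p a" "distinct (pawalk_verts b p)"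
      using pair_graph.ex_path[OF T_pg, of b a] abV VT by blast
    have "p \<noteq> []" using p F_arc[OF ab(1)] by auto
    moreover have "length p \<noteq> 1"
    proof
      assume "length p = 1"
      then obtain e where "p = [e]" by (auto simp: length_Suc_conv)
      then have "(b, a) \<in> parcs ?T" using p by (cases e) auto
      then show False using ab(2) symD[OF T_sym] by blast
    qed
    ultimately have "3 \<le> length ((a, b) # p)" by (cases p; cases "tl p") auto
    moreover have "pre_digraph.cycle (with_proj F) ((a, b) # p)"
      unfolding cycle_with_proj_iff using p ab(1) abV V TF by auto
    ultimately show False using acyc unfolding acyclic_graph_def by blast
  qed
  with TF V VT have "F = ?T" by (cases F; cases ?T) auto
  with fpm f_arc sub show ?thesis by blast
qed

text \<open>
  The edges of a forest are \<open>{u, f u}\<close> for the vertices \<open>u\<close> that are not roots, each occurring once.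
  The maps that use a non-edge are admitted on the right with weight zero, so that the sum has the
  shape required by the matrix tree theorem.
\<close>

theorem sum_rooted_forests_eq_sum_parent_maps:
  assumes H: "pair_wf_digraph H" "finite (pverts H)" "sym (parcs H)" and S: "S \<subseteq> pverts H"
    and w: "\<And>u v. (u, v) \<in> parcs H \<Longrightarrow> w u v = w v u"
  shows "(\<Sum>F\<in>rooted_spanning_forests H S. \<Prod>e\<in>edges F. edge_weight w e) =
    (\<Sum>f\<in>parent_maps (pverts H - S) (pverts H).
       \<Prod>u\<in>pverts H - S. if (u, f u) \<in> parcs H then w u (f u) else 0)"
proof -
  let ?V = "pverts H" let ?U = "?V - S"
  let ?A = "{f \<in> parent_maps ?U ?V. \<forall>u\<in>?U. (u, f u) \<in> parcs H}"
  have finU: "finite ?U" using H(2) by simp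
  have fin: "finite (parent_maps ?U ?V)"
    using H(2) finite_PiE[of ?U "\<lambda>_. ?V"] by (simp add: parent_maps_def)
  have img: "graph_of_map ?U ?V ` ?A = rooted_spanning_forests H S"
    using graph_of_map_rooted_forest[OF H S] rooted_forest_is_graph_of_map[OF H(2) S] by blast
  have inj: "inj_on (graph_of_map ?U ?V) ?A"
    by (rule inj_on_subset[OF inj_on_graph_of_map]) blast
  have "(\<Sum>F\<in>rooted_spanning_forests H S. \<Prod>e\<in>edges F. edge_weight w e) =
      (\<Sum>f\<in>?A. \<Prod>e\<in>edges (graph_of_map ?U ?V f). edge_weight w e)"
    unfolding img[symmetric] by (simp add: sum.reindex[OF inj])
  also have "\<dots> = (\<Sum>f\<in>?A. \<Prod>u\<in>?U. w u (f u))"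
    using w by (intro sum.cong refl prod_edges_graph_of_map) auto
  also have "\<dots> = (\<Sum>f\<in>?A. \<Prod>u\<in>?U. if (u, f u) \<in> parcs H then w u (f u) else 0)"
    by (intro sum.cong prod.cong) auto
  also have "\<dots> = (\<Sum>f\<in>parent_maps ?U ?V. \<Prod>u\<in>?U. if (u, f u) \<in> parcs H then w u (f u) else 0)"
    using fin finU by (intro sum.mono_neutral_left) (auto intro!: prod_zero)
  finally show ?thesis .
qed

section \<open>Laplacians of graphs\<close>

definition adjacency :: "'v pair_pre_digraph \<Rightarrow> 'v \<Rightarrow> 'v \<Rightarrow> real" where
  "adjacency H u v = of_bool ((u, v) \<in> parcs H)"

lemma laplacian_eq_card:
  "laplacian H u v = (if u = v then real (card {t. (u, t) \<in> parcs H}) else - adjacency H u v)"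
proof -
  have "out_arcs (with_proj H) u = Pair u ` {t. (u, t) \<in> parcs H}"
    by (auto simp: out_arcs_def)
  then have "out_degree (with_proj H) u = card {t. (u, t) \<in> parcs H}"
    unfolding out_degree_def by (simp add: card_image inj_on_def)
  then show ?thesis by (auto simp: laplacian_def adjacency_def)
qed

lemma (in pair_graph) laplacian_eq_lap: "laplacian G = lap (pverts G) (adjacency G)"
proof (intro ext)
  fix u v
  have "{t. (u, t) \<in> parcs G} = {t \<in> pverts G. (u, t) \<in> parcs G}" by (auto dest: in_arcsD2)
  then have "real (card {t. (u, t) \<in> parcs G}) = (\<Sum>t\<in>pverts G. adjacency G u t)"
    by (simp add: adjacency_def pair_finite_verts sum.inter_filter[symmetric] of_bool_def)
  moreover have "adjacency G u u = 0" using no_loops' by (auto simp: adjacency_def)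
  ultimately show "laplacian G u v = lap (pverts G) (adjacency G) u v"
    by (auto simp: laplacian_eq_card lap_def)
qed

text \<open>
  Together with \<open>arc_verts\<close> and \<open>sym_parcs\<close> this gives the basic facts on a graph as rules with the
  premise \<open>pair_graph\<close>.
\<close>

lemma (in pair_graph) finite_pverts: "finite (pverts G)"
  by (rule pair_finite_verts)

lemma lap_row_sum:
  assumes "finite V" "u \<in> V"
  shows "(\<Sum>v\<in>V. lap V c u v) = 0"
  using assms by (simp add: lap_def sum_subtractf)

lemma (in pair_graph) laplacian_row_sum: "u \<in> pverts G \<Longrightarrow> (\<Sum>v\<in>pverts G. laplacian G u v) = 0"
  by (simp add: laplacian_eq_lap lap_row_sum pair_finite_verts)

lemma (in pair_graph) laplacian_sym: "laplacian G u v = laplacian G v u"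
  using sym_parcs by (auto simp: laplacian_eq_card adjacency_def dest: symD)

lemma (in pair_graph) num_rooted_spanning_forests_eq_det:
  assumes S: "S \<subseteq> pverts G" and xs: "distinct xs" "set xs = pverts G - S"
  shows "real (num_rooted_spanning_forests G S) = det (mat_on xs xs (laplacian G))"
proof -
  \<comment> \<open>With unit weights the weighted sum over forests counts them.\<close>
  have "(\<Prod>e\<in>edges F. edge_weight (\<lambda>_ _. 1) e) = 1" for F :: "'a pair_pre_digraph"
    by (intro prod.neutral) (auto simp: edges_def edge_weight_eq)
  then have "real (num_rooted_spanning_forests G S) =
      (\<Sum>F\<in>rooted_spanning_forests G S. \<Prod>e\<in>edges F. edge_weight (\<lambda>_ _. 1) e)"
    by (simp add: num_rooted_spanning_forests_def)
  also have "\<dots> = (\<Sum>f\<in>parent_maps (pverts G - S) (pverts G).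
      \<Prod>u\<in>pverts G - S. if (u, f u) \<in> parcs G then 1 else 0)"
    using pair_finite_verts sym_parcs S
    by (intro sum_rooted_forests_eq_sum_parent_maps) (auto intro: pair_wf_digraph)
  also have "\<dots> = det (mat_on xs xs (laplacian G))"
    unfolding laplacian_eq_lap
    using det_lap_eq_sum_parent_maps[OF xs(1), of "pverts G" "adjacency G"] xs pair_finite_verts
    by (simp add: adjacency_def of_bool_def)
  finally show ?thesis .
qed

text \<open>
  In a connected graph, shortest paths to \<open>S\<close> form a rooted spanning forest. So the number of
  such forests, which is the determinant of the block, is not zero.
\<close>

lemma (in pair_graph) ex_inverse_laplacian:
  assumes conn: "Digraph_Component.connected (with_proj G)" and S: "S \<subseteq> pverts G" "S \<noteq> {}"
  shows "\<exists>B. is_inverse_on (pverts G - S) (laplacian G) B"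
proof -
  let ?U = "pverts G - S"
  obtain r where r: "r \<in> S" using S by blast
  then have "\<forall>v\<in>pverts G. (v, r) \<in> (parcs G)\<^sup>*"
    using connected_iff_reach[of r] conn S by blast
  then have "\<exists>f. \<exists>d :: 'a \<Rightarrow> nat. \<forall>u\<in>?U. (u, f u) \<in> parcs G \<and> d (f u) < d u"
    using r by (intro ex_decreasing_parent_map[of _ S]) blast
  then obtain g and d :: "'a \<Rightarrow> nat" where g: "\<forall>u\<in>?U. (u, g u) \<in> parcs G \<and> d (g u) < d u"
    by blast
  have "\<exists>d :: 'a \<Rightarrow> nat. \<forall>u\<in>?U. d (restrict g ?U u) < d u"
    using g by (intro exI[of _ d]) simp
  then have "restrict g ?U \<in> parent_maps ?U (pverts G)"
    using g in_arcsD2 by (auto simp: parent_maps_def)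
  then have "graph_of_map ?U (pverts G) (restrict g ?U) \<in> rooted_spanning_forests G S"
    using g S sym_parcs pair_finite_verts
    by (intro graph_of_map_rooted_forest) (auto intro: pair_wf_digraph)
  moreover have "finite (rooted_spanning_forests G S)"
  proof (rule finite_subset)
    show "rooted_spanning_forests G S \<subseteq>
        (\<lambda>E. \<lparr>pverts = pverts G, parcs = E\<rparr>) ` Pow (parcs G)"
    proof
      fix F assume "F \<in> rooted_spanning_forests G S"
      then have "pverts F = pverts G" "parcs F \<subseteq> parcs G"
        by (auto simp: rooted_spanning_forests_def spanning_def subgraph_def)
      then show "F \<in> (\<lambda>E. \<lparr>pverts = pverts G, parcs = E\<rparr>) ` Pow (parcs G)"
        by (intro image_eqI[of _ _ "parcs F"]) (cases F, auto)
    qed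
  qed (simp add: pair_finite_arcs)
  ultimately have "num_rooted_spanning_forests G S \<noteq> 0"
    unfolding num_rooted_spanning_forests_def by auto
  moreover obtain xs where xs: "set xs = ?U" "distinct xs"
    using finite_distinct_list[of ?U] pair_finite_verts by auto
  ultimately show ?thesis
    using ex_is_inverse_on[OF xs(2)] num_rooted_spanning_forests_eq_det[OF S(1) xs(2,1)] xs(1) by simp
qed

lemma dirichlet_to_neumann_eq_schur: "dirichlet_to_neumann H S = schur (pverts H - S) (laplacian H)"
  by (intro ext) (simp add: dirichlet_to_neumann_def schur_def Let_def)

text \<open>
  Off the diagonal this is the choice of the weights, where a pair that is not an edge has entry zero.
  On the diagonal it holds because the rows of the Dirichlet-to-Neumann map sum to zero.
\<close>

lemma weighted_laplacian_schur_complement_graph: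
  assumes H: "pair_graph H" and S: "S \<subseteq> pverts H" and B: "is_inverse_on (pverts H - S) (laplacian H) B"
    and w: "\<And>u v. u \<in> S \<Longrightarrow> v \<in> S \<Longrightarrow> u \<noteq> v \<Longrightarrow> w u v = - dirichlet_to_neumann H S u v"
    and uv: "u \<in> S" "v \<in> S"
  shows "weighted_laplacian (schur_complement_graph H S) w u v = dirichlet_to_neumann H S u v"
proof (cases "u = v")
  case True
  let ?D = "dirichlet_to_neumann H S"
  have fin: "finite S" using S pair_graph.finite_pverts[OF H] finite_subset by blast
  have V: "(pverts H - S) \<union> S = pverts H" using S by blast
  have rows: "(\<Sum>v\<in>(pverts H - S) \<union> S. laplacian H x v) = 0" if "x \<in> (pverts H - S) \<union> S" for x
    using that pair_graph.laplacian_row_sum[OF H] unfolding V by blast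
  have "(\<Sum>x\<in>S. ?D u x) = 0"
    unfolding dirichlet_to_neumann_eq_schur
    by (rule schur_row_sum[OF _ fin _ B rows uv(1)]) (auto simp: pair_graph.finite_pverts[OF H])
  moreover have "(\<Sum>x\<in>S. ?D u x) = ?D u u + (\<Sum>x\<in>S - {u}. ?D u x)"
    using fin uv by (simp add: sum.remove)
  moreover have "(\<Sum>x\<in>{x. (u, x) \<in> parcs (schur_complement_graph H S)}. w u x) =
      (\<Sum>x\<in>{x. (u, x) \<in> parcs (schur_complement_graph H S)}. - ?D u x)"
    using w by (intro sum.cong) (auto simp: schur_complement_graph_def)
  moreover have "\<dots> = (\<Sum>x\<in>S - {u}. - ?D u x)"
    using fin uv by (intro sum.mono_neutral_left) (auto simp: schur_complement_graph_def)
  ultimately show ?thesis using True by (simp add: weighted_laplacian_def sum_negf)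
qed (use uv w in \<open>auto simp: weighted_laplacian_def schur_complement_graph_def\<close>)

text \<open>
  The weights extended by zero to all pairs in \<open>S\<close> have the weighted Laplacian of the Schur
  complement graph as their Laplacian.
\<close>

lemma spanning_tree_enumerator_eq_det:
  assumes H: "pair_graph H" and S: "S \<subseteq> pverts H" and B: "is_inverse_on (pverts H - S) (laplacian H) B"
    and w: "\<And>u v. u \<in> S \<Longrightarrow> v \<in> S \<Longrightarrow> u \<noteq> v \<Longrightarrow> w u v = - dirichlet_to_neumann H S u v"
    and ys: "distinct ys" "set ys = S - {r}" and r: "r \<in> S"
  shows "spanning_tree_enumerator (schur_complement_graph H S) w =
    det (mat_on ys ys (dirichlet_to_neumann H S))"
proof -
  let ?D = "dirichlet_to_neumann H S" and ?K = "schur_complement_graph H S"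
  let ?c = "\<lambda>u v. if (u, v) \<in> parcs ?K then w u v else 0"
  have fin: "finite S" using S pair_graph.finite_pverts[OF H] finite_subset by blast
  have D_sym: "?D u v = ?D v u" for u v
    unfolding dirichlet_to_neumann_eq_schur
    by (rule schur_sym[OF _ B pair_graph.laplacian_sym[OF H]]) (simp add: pair_graph.finite_pverts[OF H])
  have pK: "pverts ?K = S" by (simp add: schur_complement_graph_def)
  have "spanning_tree_enumerator ?K w =
      (\<Sum>f\<in>parent_maps (S - {r}) S. \<Prod>u\<in>S - {r}. ?c u (f u))"
  proof -
    have K: "pair_wf_digraph ?K" by unfold_locales (auto simp: schur_complement_graph_def)
    have K_sym: "sym (parcs ?K)"
      using D_sym by (auto simp: schur_complement_graph_def intro!: symI)
    have w_sym: "w u v = w v u" if "(u, v) \<in> parcs ?K" for u v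
      using that w[of u v] w[of v u] D_sym[of u v] by (auto simp: schur_complement_graph_def)
    show ?thesis
      using sum_rooted_forests_eq_sum_parent_maps[OF K _ K_sym _ w_sym, of "{r}"] fin r
      by (simp add: spanning_tree_enumerator_def spanning_trees_eq_rooted_forests pK)
  qed
  also have "\<dots> = det (mat_on ys ys (lap S ?c))"
    using det_lap_eq_sum_parent_maps[OF ys(1) fin, of ?c] ys by auto
  also have "mat_on ys ys (lap S ?c) = mat_on ys ys ?D"
  proof (rule mat_on_cong)
    fix u v assume "u \<in> set ys" "v \<in> set ys"
    then have uv: "u \<in> S" "v \<in> S" using ys by auto
    have sub: "{x. (u, x) \<in> parcs ?K} = {x \<in> S. (u, x) \<in> parcs ?K}"
      by (auto simp: schur_complement_graph_def)
    have "lap S ?c u v = weighted_laplacian ?K w u v"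
      unfolding weighted_laplacian_def sub sum.inter_filter[OF fin]
      by (auto simp: lap_def schur_complement_graph_def)
    then show "lap S ?c u v = ?D u v"
      using weighted_laplacian_schur_complement_graph[OF H S B w uv] by simp
  qed
  finally show ?thesis .
qed

section \<open>Gluing along a full subgraph\<close>

text \<open>
  The names \<open>S\<close>, \<open>U1\<close> and \<open>U2\<close> stand for the interface and for the two interiors. In \<open>G\<close> they are
  represented by \<open>Inl ` S\<close>, \<open>Inl ` U1\<close> and \<open>glue_right Y ` U2\<close>.
\<close>

locale glued_graphs = G1: pair_graph G1 + G2: pair_graph G2
  for G1 G2 Y :: "'a pair_pre_digraph" +
  assumes connected1: "Digraph_Component.connected (with_proj G1)"
    and connected2: "Digraph_Component.connected (with_proj G2)"
    and Y_nonempty: "pverts Y \<noteq> {}"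
    and Y1: "induced_subgraph (with_proj Y) (with_proj G1)"
    and Y2: "induced_subgraph (with_proj Y) (with_proj G2)"
begin

abbreviation "G \<equiv> glue G1 Y G2"
abbreviation "S \<equiv> pverts Y"
abbreviation "U1 \<equiv> pverts G1 - S"
abbreviation "U2 \<equiv> pverts G2 - S"

lemma S_subset: "S \<subseteq> pverts G1" "S \<subseteq> pverts G2"
  using Y1 Y2 by (auto simp: induced_subgraph_def subgraph_def)

lemma parcs_Y1: "(u, v) \<in> parcs Y \<longleftrightarrow> u \<in> S \<and> v \<in> S \<and> (u, v) \<in> parcs G1"
  using Y1 by (auto simp: induced_subgraph_def)

lemma parcs_Y2: "(u, v) \<in> parcs Y \<longleftrightarrow> u \<in> S \<and> v \<in> S \<and> (u, v) \<in> parcs G2"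
  using Y2 by (auto simp: induced_subgraph_def)

lemma glue_right_eq_iff [simp]:
  "glue_right Y u = glue_right Y v \<longleftrightarrow> u = v"
  "glue_right Y u = Inl v \<longleftrightarrow> u = v \<and> v \<in> S"
  "Inl v = glue_right Y u \<longleftrightarrow> u = v \<and> v \<in> S"
  by (auto simp: glue_right_def)

lemma inj_glue_right: "inj_on (glue_right Y) A"
  by (simp add: inj_on_def)

lemma glue_arc_iff:
  "(x, y) \<in> parcs G \<longleftrightarrow> (\<exists>u v. (u, v) \<in> parcs G1 \<and> x = Inl u \<and> y = Inl v) \<or>
    (\<exists>u v. (u, v) \<in> parcs G2 \<and> x = glue_right Y u \<and> y = glue_right Y v)"
  by (auto simp: glue_def)

lemma Inl_arc_iff: "(Inl u, Inl v) \<in> parcs G \<longleftrightarrow> (u, v) \<in> parcs G1"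
  unfolding glue_arc_iff using parcs_Y1[of u v] parcs_Y2[of u v] by auto

lemma glue_right_arc_iff: "(glue_right Y u, glue_right Y v) \<in> parcs G \<longleftrightarrow> (u, v) \<in> parcs G2"
  unfolding glue_arc_iff using parcs_Y1[of u v] parcs_Y2[of u v] by auto

lemma no_crossing_arc:
  assumes "x \<in> Inl ` U1" "y \<in> glue_right Y ` U2"
  shows "(x, y) \<notin> parcs G" "(y, x) \<notin> parcs G"
  using assms unfolding glue_arc_iff by auto

lemma neighbours_Inl:
  assumes "u \<in> U1"
  shows "{t. (Inl u, t) \<in> parcs G} = Inl ` {t. (u, t) \<in> parcs G1}"
  using assms unfolding glue_arc_iff by auto

lemma neighbours_glue_right:
  assumes "u \<in> U2"
  shows "{t. (glue_right Y u, t) \<in> parcs G} = glue_right Y ` {t. (u, t) \<in> parcs G2}"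
  using assms unfolding glue_arc_iff by auto

lemma neighbours_interface:
  assumes "u \<in> S"
  shows "{t. (Inl u, t) \<in> parcs G} =
    Inl ` {t. (u, t) \<in> parcs G1} \<union> glue_right Y ` {t. (u, t) \<in> parcs G2}"
  using assms unfolding glue_arc_iff by auto

text \<open>
  Because \<open>Y\<close> is full in both graphs, the arcs identified by the gluing are exactly its arcs.
\<close>

lemma shared_neighbours:
  assumes "u \<in> S"
  shows "Inl ` {t. (u, t) \<in> parcs G1} \<inter> glue_right Y ` {t. (u, t) \<in> parcs G2} =
    Inl ` {t. (u, t) \<in> parcs Y}"
proof -
  have "{t. (u, t) \<in> parcs Y} = {t \<in> S. (u, t) \<in> parcs G1 \<and> (u, t) \<in> parcs G2}"
    using assms parcs_Y1[of u] parcs_Y2[of u] by blast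
  then show ?thesis by (auto simp: image_iff)
qed

lemma pair_graph_glue: "pair_graph G"
proof unfold_locales
  show "e \<in> parcs G \<Longrightarrow> fst e \<in> pverts G" for e
    by (auto simp: glue_def dest: G1.in_arcsD1 G2.in_arcsD1)
  show "e \<in> parcs G \<Longrightarrow> snd e \<in> pverts G" for e
    by (auto simp: glue_def dest: G1.in_arcsD2 G2.in_arcsD2)
  show "finite (pverts G)" "finite (parcs G)"
    by (simp_all add: glue_def G1.pair_finite_verts G2.pair_finite_verts G1.pair_finite_arcs
        G2.pair_finite_arcs)
  show "e \<in> parcs G \<Longrightarrow> fst e \<noteq> snd e" for e
    using G1.no_loops' G2.no_loops' by (cases e) (auto simp: glue_arc_iff)
  show "symmetric (with_proj G)"
    using symD[OF G1.sym_parcs] symD[OF G2.sym_parcs]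
    by (auto simp: symmetric_def glue_arc_iff intro!: symI)
qed

lemma laplacian_glue_left:
  assumes "u \<in> U1 \<or> v \<in> U1"
  shows "laplacian G (Inl u) (Inl v) = laplacian G1 u v"
  using assms neighbours_Inl[of u]
  by (auto simp: laplacian_eq_card adjacency_def Inl_arc_iff card_image)

lemma laplacian_glue_right:
  assumes "u \<in> U2 \<or> v \<in> U2"
  shows "laplacian G (glue_right Y u) (glue_right Y v) = laplacian G2 u v"
  using assms neighbours_glue_right[of u]
  by (auto simp: laplacian_eq_card adjacency_def glue_right_arc_iff  card_image[OF inj_glue_right])

lemma laplacian_glue_crossing:
  assumes "x \<in> Inl ` U1" "y \<in> glue_right Y ` U2"
  shows "laplacian G x y = 0 \<and> laplacian G y x = 0"
  using assms no_crossing_arc[OF assms]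
  by (auto simp: laplacian_eq_card adjacency_def glue_right_def split: if_splits)

text \<open>
  On the diagonal this is inclusion and exclusion for the neighbours of \<open>u\<close>. Off the diagonal, an arc
  between vertices of \<open>Y\<close> belongs to all three graphs or to none.
\<close>

lemma laplacian_glue_interface:
  assumes u: "u \<in> S" and v: "v \<in> S"
  shows "laplacian G (Inl u) (Inl v) = laplacian G1 u v + laplacian G2 u v - laplacian Y u v"
proof (cases "u = v")
  case True
  let ?A = "Inl ` {t. (u, t) \<in> parcs G1} :: ('a + 'a) set"
    and ?B = "glue_right Y ` {t. (u, t) \<in> parcs G2}"
  have "finite {t. (u, t) \<in> parcs G1}" "finite {t. (u, t) \<in> parcs G2}"
    using G1.pair_finite_verts G2.pair_finite_verts
    by (auto intro: finite_subset[of _ "pverts G1"] finite_subset[of _ "pverts G2"]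
        dest: G1.in_arcsD2 G2.in_arcsD2)
  then have "card ?A + card ?B = card (?A \<union> ?B) + card (?A \<inter> ?B)"
    by (intro card_Un_Int[OF finite_imageI finite_imageI])
  then have "card {t. (u, t) \<in> parcs G1} + card {t. (u, t) \<in> parcs G2} =
      card {t. (Inl u, t) \<in> parcs G} + card {t. (u, t) \<in> parcs Y}"
    unfolding neighbours_interface[OF u, symmetric] shared_neighbours[OF u]
    by (simp add: card_image inj_glue_right)
  then show ?thesis
    using True by (simp add: laplacian_eq_card flip: of_nat_add)
next
  case False
  then show ?thesis
    using u v parcs_Y1[of u v] parcs_Y2[of u v]
    by (simp add: laplacian_eq_card adjacency_def Inl_arc_iff)
qed

lemma glue_right_interface [simp]: "v \<in> S \<Longrightarrow> glue_right Y v = Inl v"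
  by (simp add: glue_right_def)

lemma interior_glue: "pverts G - Inl ` S = Inl ` U1 \<union> glue_right Y ` U2"
  using S_subset by (auto simp: glue_def glue_right_def)

lemma interior_disjoint: "Inl ` U1 \<inter> glue_right Y ` U2 = {}"
  by (auto simp: glue_right_def)

lemma finite_interior: "finite (Inl ` U1)" "finite (glue_right Y ` U2)"
  by (simp_all add: G1.pair_finite_verts G2.pair_finite_verts)

lemma ex_inverse_interior:
  obtains B1 B2 C1 C2 where
    "is_inverse_on U1 (laplacian G1) B1" "is_inverse_on U2 (laplacian G2) B2"
    "is_inverse_on (Inl ` U1) (laplacian G) C1" "is_inverse_on (glue_right Y ` U2) (laplacian G) C2"
proof -
  obtain B1 where B1: "is_inverse_on U1 (laplacian G1) B1"
    using G1.ex_inverse_laplacian[OF connected1 S_subset(1) Y_nonempty] by blast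
  obtain B2 where B2: "is_inverse_on U2 (laplacian G2) B2"
    using G2.ex_inverse_laplacian[OF connected2 S_subset(2) Y_nonempty] by blast
  obtain C1 where "is_inverse_on (Inl ` U1) (laplacian G) C1"
    using inverse_on_image[OF _ B1, of Inl "laplacian G"] laplacian_glue_left by auto
  moreover obtain C2 where "is_inverse_on (glue_right Y ` U2) (laplacian G) C2"
    using inverse_on_image[OF inj_glue_right B2, of "laplacian G"]
      laplacian_glue_right by auto
  ultimately show thesis using B1 B2 that by blast
qed

text \<open>
  Eliminating the interior of \<open>Gi\<close> from the Laplacian of \<open>G\<close> gives \<open>DN(Gi,Y) + L(G) - L(Gi)\<close> on \<open>Y\<close>.
  The two results overlap in \<open>L(G)\<close>, so eliminating both interiors gives
  \<open>DN(G1,Y) + DN(G2,Y) + L(G) - L(G1) - L(G2)\<close>, where \<open>L(G) = L(G1) + L(G2) - L(Y)\<close> on \<open>Y\<close>.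
\<close>

lemma dirichlet_to_neumann_glue:
  assumes u: "u \<in> S" and v: "v \<in> S"
  shows "dirichlet_to_neumann G (Inl ` S) (Inl u) (Inl v) = dirichlet_to_neumann_sum G1 Y G2 u v"
proof -
  obtain B1 B2 C1 C2 where
    B1: "is_inverse_on U1 (laplacian G1) B1" and B2: "is_inverse_on U2 (laplacian G2) B2" and
    C1: "is_inverse_on (Inl ` U1) (laplacian G) C1" and
    C2: "is_inverse_on (glue_right Y ` U2) (laplacian G) C2"
    by (rule ex_inverse_interior)
  have "schur (Inl ` U1) (laplacian G) (Inl u) (Inl v) =
      laplacian G (Inl u) (Inl v) - laplacian G1 u v + schur U1 (laplacian G1) u v"
    by (rule schur_image[OF _ _ B1]) (auto simp: laplacian_glue_left G1.pair_finite_verts)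
  moreover have "schur (glue_right Y ` U2) (laplacian G) (glue_right Y u) (glue_right Y v) =
      laplacian G (glue_right Y u) (glue_right Y v) - laplacian G2 u v + schur U2 (laplacian G2) u v"
    by (rule schur_image[OF _ inj_glue_right B2])
      (auto simp: laplacian_glue_right G2.pair_finite_verts simp del: glue_right_interface)
  moreover have "schur (Inl ` U1 \<union> glue_right Y ` U2) (laplacian G) (Inl u) (Inl v) =
      schur (Inl ` U1) (laplacian G) (Inl u) (Inl v)
      + schur (glue_right Y ` U2) (laplacian G) (Inl u) (Inl v) - laplacian G (Inl u) (Inl v)"
    by (rule schur_union[OF finite_interior interior_disjoint C1 C2 laplacian_glue_crossing])
  ultimately show ?thesis
    using u v
    unfolding dirichlet_to_neumann_sum_def dirichlet_to_neumann_eq_schur interior_glue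
    by (simp add: laplacian_glue_interface)
qed

text \<open>
  The vertices other than \<open>r\<close> are listed as the two interiors followed by the rest of the interface.
  Eliminating the interiors splits off the Dirichlet-to-Neumann map. The interiors are uncoupled, so
  eliminating the first leaves the block of the second unchanged.
\<close>

lemma num_spanning_trees_glue:
  assumes r: "r \<in> S" and ys: "distinct ys" "set ys = Inl ` S - {Inl r}"
  shows "real (num_spanning_trees G) =
    real (num_rooted_spanning_forests G1 S) * real (num_rooted_spanning_forests G2 S)
    * det (mat_on ys ys (dirichlet_to_neumann G (Inl ` S)))"
proof -
  obtain B1 B2 C1 C2 where
    C1: "is_inverse_on (Inl ` U1) (laplacian G) C1" and
    C2: "is_inverse_on (glue_right Y ` U2) (laplacian G) C2"
    by (rule ex_inverse_interior)
  obtain xs1 where xs1: "set xs1 = U1" "distinct xs1"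
    using finite_distinct_list[of U1] G1.pair_finite_verts by auto
  obtain xs2 where xs2: "set xs2 = U2" "distinct xs2"
    using finite_distinct_list[of U2] G2.pair_finite_verts by auto
  let ?zs1 = "map Inl xs1 :: ('a + 'a) list" and ?zs2 = "map (glue_right Y) xs2"
  have zs: "distinct ?zs1" "set ?zs1 = Inl ` U1" "distinct ?zs2" "set ?zs2 = glue_right Y ` U2"
    using xs1 xs2 inj_glue_right by (auto simp: distinct_map)
  have r_G: "Inl r \<in> pverts G" and S_G: "Inl ` S \<subseteq> pverts G"
    using r S_subset by (auto simp: glue_def)
  have dist: "distinct (?zs1 @ ?zs2)" and set12: "set (?zs1 @ ?zs2) = pverts G - Inl ` S"
    using zs interior_disjoint by (auto simp: interior_glue)
  have C: "is_inverse_on (set (?zs1 @ ?zs2)) (laplacian G) (\<lambda>x y. C1 x y + C2 x y)"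
    unfolding set12 interior_glue
    by (rule block_inverse[OF finite_interior interior_disjoint C1 C2 laplacian_glue_crossing])
  have "distinct ((?zs1 @ ?zs2) @ ys)" "set ((?zs1 @ ?zs2) @ ys) = pverts G - {Inl r}"
    unfolding distinct_append[of "?zs1 @ ?zs2"] set_append[of "?zs1 @ ?zs2"] set12
    using dist ys S_G r by auto
  then have "real (num_spanning_trees G) =
      det (mat_on ((?zs1 @ ?zs2) @ ys) ((?zs1 @ ?zs2) @ ys) (laplacian G))"
    using pair_graph.num_rooted_spanning_forests_eq_det[OF pair_graph_glue, of "{Inl r}"] r_G
    by (simp add: num_spanning_trees_def num_rooted_spanning_forests_def spanning_trees_eq_rooted_forests)
  also have "\<dots> = det (mat_on (?zs1 @ ?zs2) (?zs1 @ ?zs2) (laplacian G))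
      * det (mat_on ys ys (dirichlet_to_neumann G (Inl ` S)))"
    unfolding det_append_schur[OF dist C] set12 dirichlet_to_neumann_eq_schur ..
  also have "det (mat_on (?zs1 @ ?zs2) (?zs1 @ ?zs2) (laplacian G)) =
      det (mat_on ?zs1 ?zs1 (laplacian G)) * det (mat_on ?zs2 ?zs2 (schur (set ?zs1) (laplacian G)))"
    by (rule det_append_schur[OF zs(1)]) (unfold zs(2), rule C1)
  also have "mat_on ?zs2 ?zs2 (schur (set ?zs1) (laplacian G)) = mat_on ?zs2 ?zs2 (laplacian G)"
    unfolding zs(2) by (rule mat_on_cong) (simp add: schur_def zs(4) laplacian_glue_crossing del: set_map)
  also have "mat_on ?zs1 ?zs1 (laplacian G) = mat_on xs1 xs1 (laplacian G1)"
    using xs1 by (intro eq_matI) (auto simp: mat_on_def intro!: laplacian_glue_left dest: nth_mem)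
  also have "mat_on ?zs2 ?zs2 (laplacian G) = mat_on xs2 xs2 (laplacian G2)"
    using xs2 by (intro eq_matI) (auto simp: mat_on_def intro!: laplacian_glue_right dest: nth_mem)
  also have "det (mat_on xs1 xs1 (laplacian G1)) = num_rooted_spanning_forests G1 S"
    using G1.num_rooted_spanning_forests_eq_det[OF S_subset(1) xs1(2,1)] by simp
  also have "det (mat_on xs2 xs2 (laplacian G2)) = num_rooted_spanning_forests G2 S"
    using G2.num_rooted_spanning_forests_eq_det[OF S_subset(2) xs2(2,1)] by simp
  finally show ?thesis .
qed

text \<open>
  By the gluing formula the weights are those of the Schur complement graph of \<open>G\<close>. The determinant
  that remains in the spanning tree count is then a reduced weighted Laplacian of that graph.
\<close>

theorem weighted_laplacian_and_spanning_trees_glue: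
  assumes "\<And>v v'. v \<in> S \<Longrightarrow> v' \<in> S \<Longrightarrow> v \<noteq> v' \<Longrightarrow>
    w (Inl v) (Inl v') = - dirichlet_to_neumann_sum G1 Y G2 v v'"
  shows "\<forall>v\<in>S. \<forall>v'\<in>S. weighted_laplacian (schur_complement_graph G (Inl ` S)) w (Inl v) (Inl v')
      = dirichlet_to_neumann_sum G1 Y G2 v v'"
    and "real (num_spanning_trees G) =
      real (num_rooted_spanning_forests G1 S) * real (num_rooted_spanning_forests G2 S)
      * spanning_tree_enumerator (schur_complement_graph G (Inl ` S)) w"
proof -
  let ?S = "Inl ` S :: ('a + 'a) set"
  have S_G: "?S \<subseteq> pverts G" using S_subset by (auto simp: glue_def)
  have w: "w x y = - dirichlet_to_neumann G ?S x y" if xy: "x \<in> ?S" "y \<in> ?S" "x \<noteq> y" for x y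
  proof -
    obtain u v where uv: "x = Inl u" "y = Inl v" "u \<in> S" "v \<in> S" using xy by blast
    with \<open>x \<noteq> y\<close> have "u \<noteq> v" by blast
    with uv show ?thesis using assms[of u v] by (simp add: dirichlet_to_neumann_glue)
  qed
  obtain B1 B2 C1 C2 where
    C1: "is_inverse_on (Inl ` U1) (laplacian G) C1" and
    C2: "is_inverse_on (glue_right Y ` U2) (laplacian G) C2"
    by (rule ex_inverse_interior)
  have B: "is_inverse_on (pverts G - ?S) (laplacian G) (\<lambda>x y. C1 x y + C2 x y)"
    unfolding interior_glue
    by (rule block_inverse[OF finite_interior interior_disjoint C1 C2 laplacian_glue_crossing])
  obtain r where r: "r \<in> S" using Y_nonempty by blast
  obtain ys where ys: "set ys = ?S - {Inl r}" "distinct ys"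
    using finite_distinct_list[of "?S - {Inl r}"] finite_subset[OF S_subset(1) G1.pair_finite_verts] by auto
  show "\<forall>v\<in>S. \<forall>v'\<in>S. weighted_laplacian (schur_complement_graph G ?S) w (Inl v) (Inl v') =
      dirichlet_to_neumann_sum G1 Y G2 v v'"
    using weighted_laplacian_schur_complement_graph[OF pair_graph_glue S_G B w]
    by (simp add: dirichlet_to_neumann_glue)
  have "spanning_tree_enumerator (schur_complement_graph G ?S) w =
      det (mat_on ys ys (dirichlet_to_neumann G ?S))"
    using r by (intro spanning_tree_enumerator_eq_det[OF pair_graph_glue S_G B w ys(2,1)]) auto
  then show "real (num_spanning_trees G) =
      real (num_rooted_spanning_forests G1 S) * real (num_rooted_spanning_forests G2 S)
      * spanning_tree_enumerator (schur_complement_graph G ?S) w"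
    using num_spanning_trees_glue[OF r ys(2,1)] by simp
qed

end

theorem corollary3p3:
  fixes G1 G2 Y :: "'a pair_pre_digraph"
    and w :: "'a + 'a \<Rightarrow> 'a + 'a \<Rightarrow> real"
  assumes "pair_graph G1" and "Digraph_Component.connected (with_proj G1)"
    and "pair_graph G2" and "Digraph_Component.connected (with_proj G2)"
    and "pverts Y \<noteq> {}"
    and "induced_subgraph (with_proj Y) (with_proj G1)"
    and "induced_subgraph (with_proj Y) (with_proj G2)"
    and "\<And>v v'. v \<in> pverts Y \<Longrightarrow> v' \<in> pverts Y \<Longrightarrow> v \<noteq> v' \<Longrightarrow>
           w (Inl v) (Inl v') = - dirichlet_to_neumann_sum G1 Y G2 v v'"
  shows "(\<forall>v \<in> pverts Y. \<forall>v' \<in> pverts Y.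
            weighted_laplacian (schur_complement_graph (glue G1 Y G2) (Inl ` pverts Y)) w
              (Inl v) (Inl v')
            = dirichlet_to_neumann_sum G1 Y G2 v v')
      \<and> real (num_spanning_trees (glue G1 Y G2))
          = real (num_rooted_spanning_forests G1 (pverts Y))
            * real (num_rooted_spanning_forests G2 (pverts Y))
            * spanning_tree_enumerator
                (schur_complement_graph (glue G1 Y G2) (Inl ` pverts Y)) w"
proof -
  have "glued_graphs G1 G2 Y"
    using assms by (simp add: glued_graphs_def glued_graphs_axioms_def)
  from glued_graphs.weighted_laplacian_and_spanning_trees_glue[OF this, of w] assms(8) show ?thesis by blast
qed

end
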